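(* Let $(A,\cdot_A,\{\cdot,\cdot\}_A,d_A)$ be a $\lambda$-DP (respectively $\lambda$-mDP) algebra and let $(B,f,g)$ be a $\mathcal{P}$-triple of $A$. Then there exists a unique $\lambda$-differential (respectively modified $\lambda$-differential) algebra homomorphism $\phi:A^{ue}\to B$ satisfying $f=\phi M$ and $g=\phi H$, i.e. $\phi(M_a)=f(a)$ and $\phi(H_a)=g(a)$ for all $a\in A$.
   Context: $\mathbf{k}$ is a field of characteristic $0$, $\lambda\in\mathbf{k}$ is fixed. "Algebra" means unital associative $\mathbf{k}$-algebra, and algebra homomorphisms are unital. A $\lambda$-differential algebra is $(A,\cdot,d)$ with $(A,\cdot)$ an algebra and $d:A\to A$ linear such that $d(1_A)=0$ and $d(x\cdot y)=d(x)\cdot y+x\cdot d(y)+\lambda d(x)\cdot d(y)$. A modified $\lambda$-differential algebra is $(A,\cdot,d)$ with $d$ linear such that $d(x\cdot y)=d(x)\cdot y+x\cdot d(y)+\lambda x\cdot y$. A homomorphism of such is an algebra homomorphism commuting with the operators $d$. A $\lambda$-DL algebra is $(A,\{\cdot,\cdot\},d)$ with $(A,\{\cdot,\cdot\})$ a Lie algebra and $d$ linear such that $d\{x,y\}=\{d(x),y\}+\{x,d(y)\}+\lambda\{d(x),d(y)\}$. A $\lambda$-mDL algebra is the same with $d\{x,y\}=\{d(x),y\}+\{x,d(y)\}+\lambda\{x,y\}$. A homomorphism of such is a Lie algebra homomorphism commuting with the operators $d$. A $\lambda$-DP (respectively $\lambda$-mDP) algebra is a quadruple $(A,\cdot,\{\cdot,\cdot\},d)$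 such that $(A,\cdot,d)$ is a $\lambda$-differential (respectively modified $\lambda$-differential) algebra, $(A,\{\cdot,\cdot\},d)$ is a $\lambda$-DL (respectively $\lambda$-mDL) algebra, and $\{a,b\cdot c\}=\{a,b\}\cdot c+b\cdot\{a,c\}$ for all $a,b,c\in A$. Universal enveloping algebra: let $M_A=\{M_a:a\in A\}$ and $H_A=\{H_a:a\in A\}$ be two copies of the linear space $A$, with $\mathbf{k}$-linear isomorphisms $M:a\mapsto M_a$, $H:a\mapsto H_a$. Then $A^{ue}$ is the quotient of the free algebra generated by $M_A$ and $H_A$ (i.e. the tensor algebra of $M_A\oplus H_A$) by the relations, for all $a,b\in A$: $M_{ab}=M_aM_b$; $H_{\{a,b\}}=H_aH_b-H_bH_a$; $M_{\{a,b\}}=H_aM_b-M_bH_a$; $H_{ab}=M_aH_b+M_bH_a$; $M_1=1$. The maps $M,H$ are also regarded as maps $A\to A^{ue}$. $A^{ue}$ is a (modified) $\lambda$-differential algebra with the operator $D$ determined by $D(M_a)=M_{d(a)}$, $D(H_a)=H_{d(a)}$. A $\mathcal{P}$-triple of a $\lambda$-DP (respectively $\lambda$-mDP) algebra $A$ is a triple $(B,f,g)$ such that: (P1) $(B,\cdot_B,d_B)$ is a commutative $\lambda$-differential (respectively modified $\lambda$-differential) algebra and $f:(A,\cdot_A,d_A)\to(B,\cdot_B,d_B)$ is a $\lambda$-differential (respectively modified $\lambda$-differential) algebra homomorphism; (P2) $g:(A,\{\cdot,\cdot\}_A,d_A)\to(B,\{\cdot,\cdot\}_B,d_B)$ is a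 $\lambda$-DL (respectively $\lambda$-mDL) algebra homomorphism, where $\{x,y\}_B=x\cdot_By-y\cdot_Bx$; (P3) $f(\{a,b\}_A)=g(a)\cdot_Bf(b)-f(b)\cdot_Bg(a)$; (P4) $g(a\cdot_Ab)=f(a)\cdot_Bg(b)+f(b)\cdot_Bg(a)$, for all $a,b\in A$. *)

theory Defs
  imports "HOL-Algebra.QuotRing" "HOL-Algebra.Chinese_Remainder" "HOL-Algebra.Module"
begin

section \<open>Linear maps and unital associative algebras\<close>

definition char_zero :: "('k, 'm) ring_scheme \<Rightarrow> bool"
  where "char_zero K \<longleftrightarrow> (\<forall>n::nat. n > 0 \<longrightarrow> [n] \<cdot>\<^bsub>K\<^esub> \<one>\<^bsub>K\<^esub> \<noteq> \<zero>\<^bsub>K\<^esub>)"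

definition linear_map ::
    "('k, 'c) ring_scheme \<Rightarrow> ('k, 'a, 'm) module_scheme \<Rightarrow> ('k, 'b, 'n) module_scheme \<Rightarrow> ('a \<Rightarrow> 'b) \<Rightarrow> bool"
  where "linear_map K V W f \<longleftrightarrow>
    f \<in> carrier V \<rightarrow> carrier W \<and>
    (\<forall>x\<in>carrier V. \<forall>y\<in>carrier V. f (x \<oplus>\<^bsub>V\<^esub> y) = f x \<oplus>\<^bsub>W\<^esub> f y) \<and>
    (\<forall>c\<in>carrier K. \<forall>x\<in>carrier V. f (c \<odot>\<^bsub>V\<^esub> x) = c \<odot>\<^bsub>W\<^esub> f x)"

text \<open>The library locale \<^locale>\<open>algebra\<close> covers commutative algebras only.\<close>

locale assoc_algebra = module K A + A?: ring A for K (structure) and A (structure) +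
  assumes smult_mult_left:
      "\<lbrakk>c \<in> carrier K; x \<in> carrier A; y \<in> carrier A\<rbrakk>
        \<Longrightarrow> (c \<odot>\<^bsub>A\<^esub> x) \<otimes>\<^bsub>A\<^esub> y = c \<odot>\<^bsub>A\<^esub> (x \<otimes>\<^bsub>A\<^esub> y)"
    and smult_mult_right:
      "\<lbrakk>c \<in> carrier K; x \<in> carrier A; y \<in> carrier A\<rbrakk>
        \<Longrightarrow> x \<otimes>\<^bsub>A\<^esub> (c \<odot>\<^bsub>A\<^esub> y) = c \<odot>\<^bsub>A\<^esub> (x \<otimes>\<^bsub>A\<^esub> y)"

definition algebra_hom ::
    "('k, 'c) ring_scheme \<Rightarrow> ('k, 'a, 'm) module_scheme \<Rightarrow> ('k, 'b, 'n) module_scheme \<Rightarrow> ('a \<Rightarrow> 'b) \<Rightarrow> bool"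
  where "algebra_hom K A B f \<longleftrightarrow> f \<in> ring_hom A B \<and> linear_map K A B f"


section \<open>(Modified) differential algebras of weight \<open>\<lambda>\<close>\<close>

locale diff_algebra = assoc_algebra K A for K (structure) and lam and A (structure) and d +
  assumes weight_closed: "lam \<in> carrier K"
    and d_linear: "linear_map K A A d"
    and d_one: "d \<one>\<^bsub>A\<^esub> = \<zero>\<^bsub>A\<^esub>"
    and d_mult: "\<lbrakk>x \<in> carrier A; y \<in> carrier A\<rbrakk> \<Longrightarrow>
      d (x \<otimes>\<^bsub>A\<^esub> y) = d x \<otimes>\<^bsub>A\<^esub> y \<oplus>\<^bsub>A\<^esub> x \<otimes>\<^bsub>A\<^esub> d y \<oplus>\<^bsub>A\<^esub> lam \<odot>\<^bsub>A\<^esub> (d x \<otimes>\<^bsub>A\<^esub> d y)"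

locale mdiff_algebra = assoc_algebra K A for K (structure) and lam and A (structure) and d +
  assumes weight_closed: "lam \<in> carrier K"
    and d_linear: "linear_map K A A d"
    and d_mult: "\<lbrakk>x \<in> carrier A; y \<in> carrier A\<rbrakk> \<Longrightarrow>
      d (x \<otimes>\<^bsub>A\<^esub> y) = d x \<otimes>\<^bsub>A\<^esub> y \<oplus>\<^bsub>A\<^esub> x \<otimes>\<^bsub>A\<^esub> d y \<oplus>\<^bsub>A\<^esub> lam \<odot>\<^bsub>A\<^esub> (x \<otimes>\<^bsub>A\<^esub> y)"

locale diff_algebra_hom = dom: diff_algebra K lam A dA + cod: diff_algebra K lam B dB
  for K (structure) and lam and A (structure) and dA and B (structure) and dB and f +
  assumes hom: "algebra_hom K A B f"
    and comm_d: "x \<in> carrier A \<Longrightarrow> f (dA x) = dB (f x)"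

locale mdiff_algebra_hom = dom: mdiff_algebra K lam A dA + cod: mdiff_algebra K lam B dB
  for K (structure) and lam and A (structure) and dA and B (structure) and dB and f +
  assumes hom: "algebra_hom K A B f"
    and comm_d: "x \<in> carrier A \<Longrightarrow> f (dA x) = dB (f x)"


section \<open>(Modified) differential Lie algebras\<close>

text \<open>Only the vector space structure of the record \<open>L\<close> is used; the bracket is a separate argument.\<close>

locale lie_algebra = module K L for K (structure) and L (structure) and br +
  assumes br_linear_left: "y \<in> carrier L \<Longrightarrow> linear_map K L L (\<lambda>x. br x y)"
    and br_linear_right: "x \<in> carrier L \<Longrightarrow> linear_map K L L (br x)"
    and br_alternating: "x \<in> carrier L \<Longrightarrow> br x x = \<zero>\<^bsub>L\<^esub>"
    and br_jacobi: "\<lbrakk>x \<in> carrier L; y \<in> carrier L; z \<in> carrier L\<rbrakk> \<Longrightarrow>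
      br x (br y z) \<oplus>\<^bsub>L\<^esub> br y (br z x) \<oplus>\<^bsub>L\<^esub> br z (br x y) = \<zero>\<^bsub>L\<^esub>"

locale DL_algebra = lie_algebra K L br for K (structure) and lam and L (structure) and br and d +
  assumes weight_closed: "lam \<in> carrier K"
    and d_linear: "linear_map K L L d"
    and d_br: "\<lbrakk>x \<in> carrier L; y \<in> carrier L\<rbrakk> \<Longrightarrow>
      d (br x y) = br (d x) y \<oplus>\<^bsub>L\<^esub> br x (d y) \<oplus>\<^bsub>L\<^esub> lam \<odot>\<^bsub>L\<^esub> br (d x) (d y)"

locale mDL_algebra = lie_algebra K L br for K (structure) and lam and L (structure) and br and d +
  assumes weight_closed: "lam \<in> carrier K"
    and d_linear: "linear_map K L L d"
    and d_br: "\<lbrakk>x \<in> carrier L; y \<in> carrier L\<rbrakk> \<Longrightarrow>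
      d (br x y) = br (d x) y \<oplus>\<^bsub>L\<^esub> br x (d y) \<oplus>\<^bsub>L\<^esub> lam \<odot>\<^bsub>L\<^esub> br x y"

locale DL_hom = dom: DL_algebra K lam L brL dL + cod: DL_algebra K lam N brN dN
  for K (structure) and lam and L (structure) and brL and dL and N (structure) and brN and dN and g +
  assumes linear: "linear_map K L N g"
    and hom_br: "\<lbrakk>x \<in> carrier L; y \<in> carrier L\<rbrakk> \<Longrightarrow> g (brL x y) = brN (g x) (g y)"
    and comm_d: "x \<in> carrier L \<Longrightarrow> g (dL x) = dN (g x)"

locale mDL_hom = dom: mDL_algebra K lam L brL dL + cod: mDL_algebra K lam N brN dN
  for K (structure) and lam and L (structure) and brL and dL and N (structure) and brN and dN and g +
  assumes linear: "linear_map K L N g"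
    and hom_br: "\<lbrakk>x \<in> carrier L; y \<in> carrier L\<rbrakk> \<Longrightarrow> g (brL x y) = brN (g x) (g y)"
    and comm_d: "x \<in> carrier L \<Longrightarrow> g (dL x) = dN (g x)"


section \<open>(Modified) differential Poisson algebras\<close>

text \<open>The associative product is not required to be commutative.\<close>

locale DP_algebra = diff_algebra K lam A d + lie: DL_algebra K lam A br d
  for K (structure) and lam and A (structure) and br and d +
  assumes br_mult: "\<lbrakk>a \<in> carrier A; b \<in> carrier A; c \<in> carrier A\<rbrakk> \<Longrightarrow>
      br a (b \<otimes>\<^bsub>A\<^esub> c) = br a b \<otimes>\<^bsub>A\<^esub> c \<oplus>\<^bsub>A\<^esub> b \<otimes>\<^bsub>A\<^esub> br a c"

locale mDP_algebra = mdiff_algebra K lam A d + lie: mDL_algebra K lam A br d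
  for K (structure) and lam and A (structure) and br and d +
  assumes br_mult: "\<lbrakk>a \<in> carrier A; b \<in> carrier A; c \<in> carrier A\<rbrakk> \<Longrightarrow>
      br a (b \<otimes>\<^bsub>A\<^esub> c) = br a b \<otimes>\<^bsub>A\<^esub> c \<oplus>\<^bsub>A\<^esub> b \<otimes>\<^bsub>A\<^esub> br a c"


section \<open>Free algebras, quotient algebras and tensor algebras\<close>

text \<open>Elements of the free algebra on \<open>X\<close> are the finitely supported \<open>K\<close>-valued functions on the
  words over \<open>X\<close>; the product is convolution along the factorisations
  \<open>w = take i w @ drop i w\<close>.\<close>

definition free_algebra :: "('k, 'c) ring_scheme \<Rightarrow> 'x set \<Rightarrow> ('k, 'x list \<Rightarrow> 'k) module"
  where "free_algebra K X =
    \<lparr>carrier = {p. (\<forall>w. p w \<in> carrier K) \<and> finite {w. p w \<noteq> \<zero>\<^bsub>K\<^esub>} \<and>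
        (\<forall>w. p w \<noteq> \<zero>\<^bsub>K\<^esub> \<longrightarrow> set w \<subseteq> X)},
     monoid.mult = (\<lambda>p q w. \<Oplus>\<^bsub>K\<^esub>i\<in>{..length w}. p (take i w) \<otimes>\<^bsub>K\<^esub> q (drop i w)),
     one = (\<lambda>w. if w = [] then \<one>\<^bsub>K\<^esub> else \<zero>\<^bsub>K\<^esub>),
     ring.zero = (\<lambda>w. \<zero>\<^bsub>K\<^esub>),
     ring.add = (\<lambda>p q w. p w \<oplus>\<^bsub>K\<^esub> q w),
     smult = (\<lambda>c p w. c \<otimes>\<^bsub>K\<^esub> p w)\<rparr>"

definition free_gen :: "('k, 'c) ring_scheme \<Rightarrow> 'x \<Rightarrow> 'x list \<Rightarrow> 'k"
  where "free_gen K x = (\<lambda>w. if w = [x] then \<one>\<^bsub>K\<^esub> else \<zero>\<^bsub>K\<^esub>)"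

text \<open>The quotient of \<open>T\<close> by the two-sided ideal generated by \<open>S\<close>. The scalar multiplication on
  cosets is written in the same way as the library's \<^const>\<open>rcoset_mult\<close>.\<close>

definition quot_algebra :: "('k, 't, 'm) module_scheme \<Rightarrow> 't set \<Rightarrow> ('k, 't set) module"
  where "quot_algebra T S =
    ring.extend (T Quot (Idl\<^bsub>T\<^esub> S))
      \<lparr>smult = (\<lambda>c X. \<Union>x\<in>X. (Idl\<^bsub>T\<^esub> S) +>\<^bsub>T\<^esub> (c \<odot>\<^bsub>T\<^esub> x))\<rparr>"

definition quot_class :: "('k, 't, 'm) module_scheme \<Rightarrow> 't set \<Rightarrow> 't \<Rightarrow> 't set"
  where "quot_class T S x = (Idl\<^bsub>T\<^esub> S) +>\<^bsub>T\<^esub> x"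

text \<open>The tensor algebra of a vector space \<open>V\<close>: the free algebra on the set \<open>carrier V\<close> in which
  the inclusion of the generators has been made linear.\<close>

definition tensor_rels :: "('k, 'c) ring_scheme \<Rightarrow> ('k, 'v, 'm) module_scheme \<Rightarrow> ('v list \<Rightarrow> 'k) set"
  where "tensor_rels K V =
    (let F = free_algebra K (carrier V); \<iota> = free_gen K in
      {\<iota> (x \<oplus>\<^bsub>V\<^esub> y) \<ominus>\<^bsub>F\<^esub> (\<iota> x \<oplus>\<^bsub>F\<^esub> \<iota> y) | x y. x \<in> carrier V \<and> y \<in> carrier V} \<union>
      {\<iota> (c \<odot>\<^bsub>V\<^esub> x) \<ominus>\<^bsub>F\<^esub> c \<odot>\<^bsub>F\<^esub> \<iota> x | c x. c \<in> carrier K \<and> x \<in> carrier V})"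

definition tensor_algebra ::
    "('k, 'c) ring_scheme \<Rightarrow> ('k, 'v, 'm) module_scheme \<Rightarrow> ('k, ('v list \<Rightarrow> 'k) set) module"
  where "tensor_algebra K V = quot_algebra (free_algebra K (carrier V)) (tensor_rels K V)"

definition tensor_inj ::
    "('k, 'c) ring_scheme \<Rightarrow> ('k, 'v, 'm) module_scheme \<Rightarrow> 'v \<Rightarrow> ('v list \<Rightarrow> 'k) set"
  where "tensor_inj K V v = quot_class (free_algebra K (carrier V)) (tensor_rels K V) (free_gen K v)"

text \<open>The direct sum of two vector spaces; the ring multiplication carried by the record type
  is not used.\<close>

definition direct_sum ::
    "('k, 'a, 'm) module_scheme \<Rightarrow> ('k, 'b, 'n) module_scheme \<Rightarrow> ('k, 'a \<times> 'b) module"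
  where "direct_sum V W =
    ring.extend (RDirProd V W) \<lparr>smult = (\<lambda>c (x, y). (c \<odot>\<^bsub>V\<^esub> x, c \<odot>\<^bsub>W\<^esub> y))\<rparr>"


section \<open>The universal enveloping algebra\<close>

text \<open>The two copies of \<open>A\<close> are the two summands of \<open>A \<oplus> A\<close>; \<open>pre_M\<close> and \<open>pre_H\<close> are the
  maps \<open>a \<mapsto> M_a\<close> and \<open>a \<mapsto> H_a\<close> into the tensor algebra.\<close>

definition pre_M :: "('k, 'c) ring_scheme \<Rightarrow> ('k, 'a, 'm) module_scheme \<Rightarrow> 'a \<Rightarrow> (('a \<times> 'a) list \<Rightarrow> 'k) set"
  where "pre_M K A a = tensor_inj K (direct_sum A A) (a, \<zero>\<^bsub>A\<^esub>)"

definition pre_H :: "('k, 'c) ring_scheme \<Rightarrow> ('k, 'a, 'm) module_scheme \<Rightarrow> 'a \<Rightarrow> (('a \<times> 'a) list \<Rightarrow> 'k) set"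
  where "pre_H K A a = tensor_inj K (direct_sum A A) (\<zero>\<^bsub>A\<^esub>, a)"

definition ue_rels ::
    "('k, 'c) ring_scheme \<Rightarrow> ('k, 'a, 'm) module_scheme \<Rightarrow> ('a \<Rightarrow> 'a \<Rightarrow> 'a) \<Rightarrow> (('a \<times> 'a) list \<Rightarrow> 'k) set set"
  where "ue_rels K A br =
    (let T = tensor_algebra K (direct_sum A A); M = pre_M K A; H = pre_H K A in
      {M (a \<otimes>\<^bsub>A\<^esub> b) \<ominus>\<^bsub>T\<^esub> M a \<otimes>\<^bsub>T\<^esub> M b | a b. a \<in> carrier A \<and> b \<in> carrier A} \<union>
      {H (br a b) \<ominus>\<^bsub>T\<^esub> (H a \<otimes>\<^bsub>T\<^esub> H b \<ominus>\<^bsub>T\<^esub> H b \<otimes>\<^bsub>T\<^esub> H a) | a b. a \<in> carrier A \<and> b \<in> carrier A} \<union>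
      {M (br a b) \<ominus>\<^bsub>T\<^esub> (H a \<otimes>\<^bsub>T\<^esub> M b \<ominus>\<^bsub>T\<^esub> M b \<otimes>\<^bsub>T\<^esub> H a) | a b. a \<in> carrier A \<and> b \<in> carrier A} \<union>
      {H (a \<otimes>\<^bsub>A\<^esub> b) \<ominus>\<^bsub>T\<^esub> (M a \<otimes>\<^bsub>T\<^esub> H b \<oplus>\<^bsub>T\<^esub> M b \<otimes>\<^bsub>T\<^esub> H a) | a b. a \<in> carrier A \<and> b \<in> carrier A} \<union>
      {M \<one>\<^bsub>A\<^esub> \<ominus>\<^bsub>T\<^esub> \<one>\<^bsub>T\<^esub>})"

definition ue ::
    "('k, 'c) ring_scheme \<Rightarrow> ('k, 'a, 'm) module_scheme \<Rightarrow> ('a \<Rightarrow> 'a \<Rightarrow> 'a)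
      \<Rightarrow> ('k, (('a \<times> 'a) list \<Rightarrow> 'k) set set) module"
  where "ue K A br = quot_algebra (tensor_algebra K (direct_sum A A)) (ue_rels K A br)"

definition ue_M ::
    "('k, 'c) ring_scheme \<Rightarrow> ('k, 'a, 'm) module_scheme \<Rightarrow> ('a \<Rightarrow> 'a \<Rightarrow> 'a) \<Rightarrow> 'a \<Rightarrow> (('a \<times> 'a) list \<Rightarrow> 'k) set set"
  where "ue_M K A br a = quot_class (tensor_algebra K (direct_sum A A)) (ue_rels K A br) (pre_M K A a)"

definition ue_H ::
    "('k, 'c) ring_scheme \<Rightarrow> ('k, 'a, 'm) module_scheme \<Rightarrow> ('a \<Rightarrow> 'a \<Rightarrow> 'a) \<Rightarrow> 'a \<Rightarrow> (('a \<times> 'a) list \<Rightarrow> 'k) set set"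
  where "ue_H K A br a = quot_class (tensor_algebra K (direct_sum A A)) (ue_rels K A br) (pre_H K A a)"

text \<open>The operator \<open>D\<close> on the enveloping algebra, determined by its values on the generators and
  the (modified) differential algebra axioms. Restricting to \<^const>\<open>extensional\<close> functions makes it
  unique as a HOL function. Its existence is part of the conclusion that a map out of
  \<open>(ue K A br, D)\<close> is a homomorphism, as the homomorphism locales above include the axioms of the
  domain.\<close>

definition ue_diff ::
    "('k, 'c) ring_scheme \<Rightarrow> 'k \<Rightarrow> ('k, 'a, 'm) module_scheme \<Rightarrow> ('a \<Rightarrow> 'a \<Rightarrow> 'a) \<Rightarrow> ('a \<Rightarrow> 'a)
      \<Rightarrow> (('a \<times> 'a) list \<Rightarrow> 'k) set set \<Rightarrow> (('a \<times> 'a) list \<Rightarrow> 'k) set set"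
  where "ue_diff K lam A br d =
    (THE D. D \<in> extensional (carrier (ue K A br)) \<and> diff_algebra K lam (ue K A br) D \<and>
      (\<forall>a\<in>carrier A. D (ue_M K A br a) = ue_M K A br (d a) \<and> D (ue_H K A br a) = ue_H K A br (d a)))"

definition ue_mdiff ::
    "('k, 'c) ring_scheme \<Rightarrow> 'k \<Rightarrow> ('k, 'a, 'm) module_scheme \<Rightarrow> ('a \<Rightarrow> 'a \<Rightarrow> 'a) \<Rightarrow> ('a \<Rightarrow> 'a)
      \<Rightarrow> (('a \<times> 'a) list \<Rightarrow> 'k) set set \<Rightarrow> (('a \<times> 'a) list \<Rightarrow> 'k) set set"
  where "ue_mdiff K lam A br d =
    (THE D. D \<in> extensional (carrier (ue K A br)) \<and> mdiff_algebra K lam (ue K A br) D \<and>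
      (\<forall>a\<in>carrier A. D (ue_M K A br a) = ue_M K A br (d a) \<and> D (ue_H K A br a) = ue_H K A br (d a)))"


section \<open>\<open>\<P>\<close>-triples\<close>

definition commutator :: "('b, 'm) ring_scheme \<Rightarrow> 'b \<Rightarrow> 'b \<Rightarrow> 'b"
  where "commutator B x y = x \<otimes>\<^bsub>B\<^esub> y \<ominus>\<^bsub>B\<^esub> y \<otimes>\<^bsub>B\<^esub> x"

locale P_triple =
  f: diff_algebra_hom K lam A dA B dB f + B: cring B + g: DL_hom K lam A brA dA B "commutator B" dB g
  for K (structure) and lam and A (structure) and brA and dA and B (structure) and dB and f and g +
  assumes P3: "\<lbrakk>a \<in> carrier A; b \<in> carrier A\<rbrakk> \<Longrightarrow> f (brA a b) = g a \<otimes>\<^bsub>B\<^esub> f b \<ominus>\<^bsub>B\<^esub> f b \<otimes>\<^bsub>B\<^esub> g a"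
    and P4: "\<lbrakk>a \<in> carrier A; b \<in> carrier A\<rbrakk> \<Longrightarrow> g (a \<otimes>\<^bsub>A\<^esub> b) = f a \<otimes>\<^bsub>B\<^esub> g b \<oplus>\<^bsub>B\<^esub> f b \<otimes>\<^bsub>B\<^esub> g a"

locale mP_triple =
  f: mdiff_algebra_hom K lam A dA B dB f + B: cring B + g: mDL_hom K lam A brA dA B "commutator B" dB g
  for K (structure) and lam and A (structure) and brA and dA and B (structure) and dB and f and g +
  assumes P3: "\<lbrakk>a \<in> carrier A; b \<in> carrier A\<rbrakk> \<Longrightarrow> f (brA a b) = g a \<otimes>\<^bsub>B\<^esub> f b \<ominus>\<^bsub>B\<^esub> f b \<otimes>\<^bsub>B\<^esub> g a"
    and P4: "\<lbrakk>a \<in> carrier A; b \<in> carrier A\<rbrakk> \<Longrightarrow> g (a \<otimes>\<^bsub>A\<^esub> b) = f a \<otimes>\<^bsub>B\<^esub> g b \<oplus>\<^bsub>B\<^esub> f b \<otimes>\<^bsub>B\<^esub> g a"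

end

theory Submission
  imports Defs
begin

text \<open>The enveloping algebra is a quotient of a free algebra, so homomorphisms out of it to an
  associative algebra \<open>C\<close> correspond to pairs of linear maps \<open>A \<rightarrow> C\<close> satisfying the defining
  relations. Its differential comes from the same universal property: a linear map \<open>D\<close> on \<open>C\<close> is a
  differential of weight \<open>\<lambda>\<close> iff \<open>x \<mapsto> x + \<epsilon> D(x)\<close> is an algebra homomorphism from \<open>C\<close> to
  \<open>C[\<epsilon>]\<close> with \<open>\<epsilon>\<^sup>2 = \<lambda> \<epsilon>\<close>. Existence and uniqueness of the differential, and the fact that \<open>\<phi>\<close>
  commutes with it, thus become statements about homomorphisms out of the enveloping algebra. The
  modified case of weight \<open>\<lambda>\<close> is the ordinary case of weight \<open>0\<close> for \<open>d + \<lambda> id\<close>.\<close>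

section \<open>Free algebras\<close>

text \<open>The obstacle is well-definedness. An operator obeying a Leibniz rule is not a
  homomorphism, so prescribing it on generators would require a formula for all words, with powers
  of \<lambda>, and a proof that it preserves the ideals of two successive quotients. In
  C[\<epsilon>] the rule becomes multiplicativity: the \<epsilon> part of (x + \<epsilon> D(x))(y +
  \<epsilon> D(y)) is D(x)y + xD(y) + \<lambda> D(x)D(y), where the last term comes from the square
  of \<epsilon>, and preservation of the unit says D(1) = 0. What remains to be checked is the
  defining relations on generators.

  A modified operator does not fit this pattern directly: its rule contains \<lambda>xy, and it
  sends 1 to -\<lambda>1. Adding \<lambda> id repairs both. The product and the bracket, and with
  them the enveloping algebra, do not change under this shift, so the weight 0 results apply to the
  same algebra.\<close>

definition free_word :: "('k, 'c) ring_scheme \<Rightarrow> 'x list \<Rightarrow> 'x list \<Rightarrow> 'k"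
  where "free_word K u = (\<lambda>w. if w = u then \<one>\<^bsub>K\<^esub> else \<zero>\<^bsub>K\<^esub>)"

lemma free_algebra_simps:
  "carrier (free_algebra K X) = {p. (\<forall>w. p w \<in> carrier K) \<and> finite {w. p w \<noteq> \<zero>\<^bsub>K\<^esub>} \<and>
     (\<forall>w. p w \<noteq> \<zero>\<^bsub>K\<^esub> \<longrightarrow> set w \<subseteq> X)}"
  "p \<otimes>\<^bsub>free_algebra K X\<^esub> q = (\<lambda>w. \<Oplus>\<^bsub>K\<^esub>i\<in>{..length w}. p (take i w) \<otimes>\<^bsub>K\<^esub> q (drop i w))"
  "\<one>\<^bsub>free_algebra K X\<^esub> = free_word K []"
  "\<zero>\<^bsub>free_algebra K X\<^esub> = (\<lambda>w. \<zero>\<^bsub>K\<^esub>)"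
  "p \<oplus>\<^bsub>free_algebra K X\<^esub> q = (\<lambda>w. p w \<oplus>\<^bsub>K\<^esub> q w)"
  "c \<odot>\<^bsub>free_algebra K X\<^esub> p = (\<lambda>w. c \<otimes>\<^bsub>K\<^esub> p w)"
  by (simp_all add: free_algebra_def free_word_def)

lemma free_gen_eq_free_word: "free_gen K x = free_word K [x]"
  by (simp add: free_gen_def free_word_def)

text \<open>Both sides sum \<open>t j k\<close> over the triangle j + k \<le> n, on the left along
  the diagonals j + k = i, on the right along the columns. This regrouping is behind the
  associativity of a convolution product.\<close>

lemma (in abelian_monoid) finsum_triangle_swap:
  assumes "\<And>i j. t i j \<in> carrier G"
  shows "(\<Oplus>i\<in>{..n::nat}. \<Oplus>j\<in>{..i}. t j (i - j)) = (\<Oplus>j\<in>{..n}. \<Oplus>k\<in>{..n - j}. t j k)"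
proof (induction n)
  case 0
  then show ?case using assms by simp
next
  case (Suc n)
  have "(\<Oplus>j\<in>{..Suc n}. \<Oplus>k\<in>{..Suc n - j}. t j k)
      = t (Suc n) 0 \<oplus> (\<Oplus>j\<in>{..n}. \<Oplus>k\<in>{..Suc n - j}. t j k)"
    using assms by simp
  \<comment> \<open>Each column j \<le> n gains one entry; together with \<open>t (Suc n) 0\<close>
    these entries form the new diagonal j + k = n + 1.\<close>
  also have "(\<Oplus>j\<in>{..n}. \<Oplus>k\<in>{..Suc n - j}. t j k)
      = (\<Oplus>j\<in>{..n}. t j (Suc n - j) \<oplus> (\<Oplus>k\<in>{..n - j}. t j k))"
    using assms by (intro finsum_cong') (auto simp: Suc_diff_le)
  also have "\<dots> = (\<Oplus>j\<in>{..n}. t j (Suc n - j)) \<oplus> (\<Oplus>j\<in>{..n}. \<Oplus>k\<in>{..n - j}. t j k)"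
    using assms by (intro finsum_addf) auto
  finally show ?case
    using assms by (simp add: Suc.IH[symmetric] a_assoc)
qed

context cring
begin

lemma free_algebra_coeff_closed: "p \<in> carrier (free_algebra R X) \<Longrightarrow> p w \<in> carrier R"
  by (simp add: free_algebra_simps)

lemma free_algebra_support: "p \<in> carrier (free_algebra R X) \<Longrightarrow> p w \<noteq> \<zero> \<Longrightarrow> set w \<subseteq> X"
  by (simp add: free_algebra_simps)

lemma free_word_closed: "set u \<subseteq> X \<Longrightarrow> free_word R u \<in> carrier (free_algebra R X)"
  by (auto simp: free_algebra_simps free_word_def)

text \<open>A nonzero coefficient at \<open>w\<close> forces a cut of \<open>w\<close> into a word
  of the support of \<open>p\<close> and one of the support of \<open>q\<close>. The support of the
  product thus consists of concatenations from two finite sets.\<close>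

lemma free_algebra_mult_closed:
  assumes "p \<in> carrier (free_algebra R X)" "q \<in> carrier (free_algebra R X)"
  shows "p \<otimes>\<^bsub>free_algebra R X\<^esub> q \<in> carrier (free_algebra R X)"
proof -
  let ?r = "p \<otimes>\<^bsub>free_algebra R X\<^esub> q"
  note coeff = assms[THEN free_algebra_coeff_closed]
  have split: "\<exists>u v. w = u @ v \<and> p u \<noteq> \<zero> \<and> q v \<noteq> \<zero>" if "?r w \<noteq> \<zero>" for w
  proof (rule ccontr)
    assume *: "\<not> ?thesis"
    have "p (take i w) = \<zero> \<or> q (drop i w) = \<zero>" for i
      using * append_take_drop_id[of i w] by metis
    then have "p (take i w) \<otimes> q (drop i w) = \<zero>" for i
      using coeff by (metis l_null r_null)
    then have "?r w = \<zero>"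
      by (simp add: free_algebra_simps)
    with that show False by simp
  qed
  have "{w. ?r w \<noteq> \<zero>} \<subseteq> (\<lambda>(u, v). u @ v) ` ({w. p w \<noteq> \<zero>} \<times> {w. q w \<noteq> \<zero>})"
    using split by fastforce
  moreover have "finite ((\<lambda>(u, v). u @ v) ` ({w. p w \<noteq> \<zero>} \<times> {w. q w \<noteq> \<zero>}))"
    using assms by (simp add: free_algebra_simps)
  ultimately have "finite {w. ?r w \<noteq> \<zero>}"
    by (rule finite_subset)
  moreover have "set w \<subseteq> X" if "?r w \<noteq> \<zero>" for w
    using split[OF that] assms[THEN free_algebra_support] by fastforce
  moreover have "?r w \<in> carrier R" for w
    using coeff by (simp add: free_algebra_simps Pi_def)
  ultimately show ?thesis
    by (subst free_algebra_simps(1)) blast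
qed

lemma free_algebra_add_closed:
  assumes "p \<in> carrier (free_algebra R X)" "q \<in> carrier (free_algebra R X)"
  shows "p \<oplus>\<^bsub>free_algebra R X\<^esub> q \<in> carrier (free_algebra R X)"
proof -
  have "{w. p w \<oplus> q w \<noteq> \<zero>} \<subseteq> {w. p w \<noteq> \<zero>} \<union> {w. q w \<noteq> \<zero>}"
    by auto
  moreover have "finite ({w. p w \<noteq> \<zero>} \<union> {w. q w \<noteq> \<zero>})"
    using assms by (simp add: free_algebra_simps)
  ultimately have "finite {w. p w \<oplus> q w \<noteq> \<zero>}"
    by (rule finite_subset)
  moreover have "set w \<subseteq> X" if "p w \<oplus> q w \<noteq> \<zero>" for w
    using that free_algebra_support[OF assms(1), of w] free_algebra_support[OF assms(2), of w]
      free_algebra_coeff_closed[OF assms(2)]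
    by (cases "p w = \<zero>") auto
  ultimately show ?thesis
    using assms by (simp add: free_algebra_simps)
qed

lemma free_algebra_smult_closed:
  assumes "c \<in> carrier R" "p \<in> carrier (free_algebra R X)"
  shows "c \<odot>\<^bsub>free_algebra R X\<^esub> p \<in> carrier (free_algebra R X)"
proof -
  have "{w. c \<otimes> p w \<noteq> \<zero>} \<subseteq> {w. p w \<noteq> \<zero>}"
    using assms by auto
  moreover have "finite {w. p w \<noteq> \<zero>}"
    using assms by (simp add: free_algebra_simps)
  ultimately have "finite {w. c \<otimes> p w \<noteq> \<zero>}"
    by (rule finite_subset)
  moreover have "set w \<subseteq> X" if "c \<otimes> p w \<noteq> \<zero>" for w
    using that free_algebra_support[OF assms(2), of w] assms(1) by (cases "p w = \<zero>") auto
  ultimately show ?thesis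
    using assms by (simp add: free_algebra_simps)
qed

lemma free_algebra_mult_assoc:
  assumes "p \<in> carrier (free_algebra R X)" "q \<in> carrier (free_algebra R X)"
    "r \<in> carrier (free_algebra R X)"
  shows "(p \<otimes>\<^bsub>free_algebra R X\<^esub> q) \<otimes>\<^bsub>free_algebra R X\<^esub> r
    = p \<otimes>\<^bsub>free_algebra R X\<^esub> (q \<otimes>\<^bsub>free_algebra R X\<^esub> r)"
proof
  fix w
  note coeff [simp] = assms[THEN free_algebra_coeff_closed]
  \<comment> \<open>The term for the cut of \<open>w\<close> into pieces of lengths
    \<open>j\<close>, \<open>k\<close> and the rest. Bracketing to the left has as outer index the
    end i = j + k of the second piece, bracketing to the right the end \<open>j\<close> of the
    first.\<close>
  define t where "t j k = p (take j w) \<otimes> (q (take k (drop j w)) \<otimes> r (drop (j + k) w))" for j k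
  have t [simp]: "t j k \<in> carrier R" for j k
    by (simp add: t_def)
  have "((p \<otimes>\<^bsub>free_algebra R X\<^esub> q) \<otimes>\<^bsub>free_algebra R X\<^esub> r) w
      = (\<Oplus>i\<in>{..length w}. \<Oplus>j\<in>{..i}. t j (i - j))"
    unfolding free_algebra_simps
  proof (intro finsum_cong')
    fix i assume "i \<in> {..length w}"
    then show "(\<Oplus>j\<in>{..length (take i w)}. p (take j (take i w)) \<otimes> q (drop j (take i w))) \<otimes> r (drop i w)
        = (\<Oplus>j\<in>{..i}. t j (i - j))"
      by (subst finsum_ldistr)
        (auto intro!: finsum_cong' simp: t_def m_assoc drop_take min_def)
  qed auto
  also have "\<dots> = (\<Oplus>j\<in>{..length w}. \<Oplus>k\<in>{..length w - j}. t j k)"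
    by (rule finsum_triangle_swap) simp
  also have "\<dots> = (p \<otimes>\<^bsub>free_algebra R X\<^esub> (q \<otimes>\<^bsub>free_algebra R X\<^esub> r)) w"
    unfolding free_algebra_simps
  proof (intro finsum_cong')
    fix j assume "j \<in> {..length w}"
    then show "(\<Oplus>k\<in>{..length w - j}. t j k)
        = p (take j w) \<otimes> (\<Oplus>k\<in>{..length (drop j w)}. q (take k (drop j w)) \<otimes> r (drop k (drop j w)))"
      by (subst finsum_rdistr) (auto intro!: finsum_cong' simp: t_def add.commute)
  qed auto
  finally show "((p \<otimes>\<^bsub>free_algebra R X\<^esub> q) \<otimes>\<^bsub>free_algebra R X\<^esub> r) w
      = (p \<otimes>\<^bsub>free_algebra R X\<^esub> (q \<otimes>\<^bsub>free_algebra R X\<^esub> r)) w" .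
qed

text \<open>Among the cuts of a word only the one at \<open>length u\<close> can match both factors,
  so the convolution sum has at most one nonzero term.\<close>

lemma free_word_mult:
  "free_word R u \<otimes>\<^bsub>free_algebra R X\<^esub> free_word R v = free_word R (u @ v)"
proof
  fix w
  show "(free_word R u \<otimes>\<^bsub>free_algebra R X\<^esub> free_word R v) w = free_word R (u @ v) w"
  proof (cases "w = u @ v")
    case True
    have "(\<Oplus>i\<in>{..length w}. free_word R u (take i w) \<otimes> free_word R v (drop i w))
        = (\<Oplus>i\<in>{..length w}. if length u = i then \<one> else \<zero>)"
    proof (intro finsum_cong')
      fix i assume "i \<in> {..length w}"
      then have "take i w = u \<longleftrightarrow> length u = i"
        using True by (metis append_eq_conv_conj atMost_iff length_take min.absorb2)
      then show "free_word R u (take i w) \<otimes> free_word R v (drop i w)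
          = (if length u = i then \<one> else \<zero>)"
        using True by (auto simp: free_word_def)
    qed auto
    also have "\<dots> = \<one>"
      using True by (intro finsum_singleton) auto
    finally show ?thesis
      using True by (simp add: free_algebra_simps free_word_def)
  next
    case False
    then have "free_word R u (take i w) \<otimes> free_word R v (drop i w) = \<zero>" for i
      by (metis append_take_drop_id free_word_def l_null one_closed r_null zero_closed)
    with False show ?thesis
      by (simp add: free_algebra_simps free_word_def)
  qed
qed

lemma free_algebra_one_mult:
  assumes "p \<in> carrier (free_algebra R X)"
  shows "\<one>\<^bsub>free_algebra R X\<^esub> \<otimes>\<^bsub>free_algebra R X\<^esub> p = p"
    and "p \<otimes>\<^bsub>free_algebra R X\<^esub> \<one>\<^bsub>free_algebra R X\<^esub> = p"
proof -
  note coeff [simp] = assms[THEN free_algebra_coeff_closed]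
  show "\<one>\<^bsub>free_algebra R X\<^esub> \<otimes>\<^bsub>free_algebra R X\<^esub> p = p"
  proof
    fix w
    have "(\<Oplus>i\<in>{..length w}. free_word R [] (take i w) \<otimes> p (drop i w))
        = (\<Oplus>i\<in>{..length w}. if 0 = i then p (drop i w) else \<zero>)"
      by (intro finsum_cong') (auto simp: free_word_def)
    also have "\<dots> = p (drop 0 w)"
      by (intro finsum_singleton) auto
    finally show "(\<one>\<^bsub>free_algebra R X\<^esub> \<otimes>\<^bsub>free_algebra R X\<^esub> p) w = p w"
      by (simp add: free_algebra_simps)
  qed
  show "p \<otimes>\<^bsub>free_algebra R X\<^esub> \<one>\<^bsub>free_algebra R X\<^esub> = p"
  proof
    fix w
    have "(\<Oplus>i\<in>{..length w}. p (take i w) \<otimes> free_word R [] (drop i w))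
        = (\<Oplus>i\<in>{..length w}. if length w = i then p (take i w) else \<zero>)"
      by (intro finsum_cong') (auto simp: free_word_def)
    also have "\<dots> = p (take (length w) w)"
      by (intro finsum_singleton) auto
    finally show "(p \<otimes>\<^bsub>free_algebra R X\<^esub> \<one>\<^bsub>free_algebra R X\<^esub>) w = p w"
      by (simp add: free_algebra_simps)
  qed
qed

lemma free_algebra_is_abelian_group: "abelian_group (free_algebra R X)"
proof (rule abelian_groupI)
  fix p assume p: "p \<in> carrier (free_algebra R X)"
  note coeff [simp] = free_algebra_coeff_closed[OF p]
  \<comment> \<open>Taking the negative as a scalar multiple of \<open>p\<close> gets its finite
    support from closure under scalars.\<close>
  have "(\<ominus> \<one>) \<odot>\<^bsub>free_algebra R X\<^esub> p \<in> carrier (free_algebra R X)"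
    using p by (intro free_algebra_smult_closed) auto
  moreover have "(\<ominus> \<one>) \<odot>\<^bsub>free_algebra R X\<^esub> p \<oplus>\<^bsub>free_algebra R X\<^esub> p = \<zero>\<^bsub>free_algebra R X\<^esub>"
    by (simp add: free_algebra_simps l_minus l_neg)
  ultimately show "\<exists>q\<in>carrier (free_algebra R X). q \<oplus>\<^bsub>free_algebra R X\<^esub> p = \<zero>\<^bsub>free_algebra R X\<^esub>"
    by blast
qed (auto simp: free_algebra_add_closed,
    auto simp: free_algebra_simps a_ac fun_eq_iff)

lemma free_algebra_assoc_algebra: "assoc_algebra R (free_algebra R X)"
proof -
  let ?F = "free_algebra R X"
  have "ring ?F"
  proof (rule ringI)
    show "Group.monoid ?F"
      using free_word_closed[of "[]" X]
      by (intro monoidI)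
        (simp_all add: free_algebra_mult_closed free_algebra_mult_assoc free_algebra_one_mult
          free_algebra_simps(3)[symmetric, where X = X])
  next
    fix p q r assume F: "p \<in> carrier ?F" "q \<in> carrier ?F" "r \<in> carrier ?F"
    note coeff [simp] = F[THEN free_algebra_coeff_closed]
    show "(p \<oplus>\<^bsub>?F\<^esub> q) \<otimes>\<^bsub>?F\<^esub> r = p \<otimes>\<^bsub>?F\<^esub> r \<oplus>\<^bsub>?F\<^esub> q \<otimes>\<^bsub>?F\<^esub> r"
      by (simp add: free_algebra_simps l_distr finsum_addf Pi_def)
    show "r \<otimes>\<^bsub>?F\<^esub> (p \<oplus>\<^bsub>?F\<^esub> q) = r \<otimes>\<^bsub>?F\<^esub> p \<oplus>\<^bsub>?F\<^esub> r \<otimes>\<^bsub>?F\<^esub> q"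
      by (simp add: free_algebra_simps r_distr finsum_addf Pi_def)
  qed (rule free_algebra_is_abelian_group)
  moreover have "module R ?F"
    by (rule moduleI[OF is_cring free_algebra_is_abelian_group])
      (auto simp: free_algebra_smult_closed,
       auto simp: free_algebra_simps l_distr r_distr m_assoc fun_eq_iff)
  moreover have "assoc_algebra_axioms R ?F"
  proof
    fix c p q assume F: "c \<in> carrier R" "p \<in> carrier ?F" "q \<in> carrier ?F"
    note coeff [simp] = F(1) F(2,3)[THEN free_algebra_coeff_closed]
    show "(c \<odot>\<^bsub>?F\<^esub> p) \<otimes>\<^bsub>?F\<^esub> q = c \<odot>\<^bsub>?F\<^esub> (p \<otimes>\<^bsub>?F\<^esub> q)"
      by (simp add: free_algebra_simps m_assoc finsum_rdistr Pi_def)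
    show "p \<otimes>\<^bsub>?F\<^esub> (c \<odot>\<^bsub>?F\<^esub> q) = c \<odot>\<^bsub>?F\<^esub> (p \<otimes>\<^bsub>?F\<^esub> q)"
      by (simp add: free_algebra_simps m_lcomm finsum_rdistr Pi_def)
  qed
  ultimately show ?thesis
    by (intro assoc_algebra.intro)
qed

text \<open>Induction on the support: one word splits off as a monomial, and the remainder has a
  smaller support. It reduces linear statements about the free algebra to words.\<close>

lemma free_algebra_span_induct [consumes 1, case_names zero smult_word add]:
  assumes "p \<in> carrier (free_algebra R X)"
    and zero: "P \<zero>\<^bsub>free_algebra R X\<^esub>"
    and smult_word: "\<And>c w. c \<in> carrier R \<Longrightarrow> set w \<subseteq> X \<Longrightarrow> P (c \<odot>\<^bsub>free_algebra R X\<^esub> free_word R w)"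
    and add: "\<And>p q. p \<in> carrier (free_algebra R X) \<Longrightarrow> q \<in> carrier (free_algebra R X) \<Longrightarrow>
      P p \<Longrightarrow> P q \<Longrightarrow> P (p \<oplus>\<^bsub>free_algebra R X\<^esub> q)"
  shows "P p"
proof -
  have "\<forall>p\<in>carrier (free_algebra R X). {w. p w \<noteq> \<zero>} = S \<longrightarrow> P p" if "finite S" for S
    using that
  proof (induction S)
    case empty
    have "p = \<zero>\<^bsub>free_algebra R X\<^esub>" if "{w. p w \<noteq> \<zero>} = {}" for p
      using that by (auto simp: free_algebra_simps)
    with zero show ?case by metis
  next
    case (insert w S)
    show ?case
    proof (intro ballI impI)
      fix p assume p: "p \<in> carrier (free_algebra R X)" and supp: "{w. p w \<noteq> \<zero>} = insert w S"
      define q where "q = p(w := \<zero>)"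
      have supp_q: "{w. q w \<noteq> \<zero>} = S"
        using supp insert.hyps by (auto simp: q_def)
      have q: "q \<in> carrier (free_algebra R X)"
        using p supp_q insert.hyps by (auto simp: free_algebra_simps q_def)
      have w: "set w \<subseteq> X"
        using p supp by (auto simp: free_algebra_simps)
      note coeff [simp] = free_algebra_coeff_closed[OF p]
      have "p = p w \<odot>\<^bsub>free_algebra R X\<^esub> free_word R w \<oplus>\<^bsub>free_algebra R X\<^esub> q"
        by (auto simp: free_algebra_simps free_word_def q_def)
      moreover have "P (p w \<odot>\<^bsub>free_algebra R X\<^esub> free_word R w \<oplus>\<^bsub>free_algebra R X\<^esub> q)"
        using insert.IH q supp_q w
        by (intro add smult_word free_algebra_smult_closed free_word_closed) auto
      ultimately show "P p" by simp
    qed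
  qed
  with assms(1) show ?thesis
    by (auto simp: free_algebra_simps)
qed

end

section \<open>Algebra homomorphisms\<close>

lemma linear_mapD:
  assumes "linear_map K V W f"
  shows "x \<in> carrier V \<Longrightarrow> f x \<in> carrier W"
    and "x \<in> carrier V \<Longrightarrow> y \<in> carrier V \<Longrightarrow> f (x \<oplus>\<^bsub>V\<^esub> y) = f x \<oplus>\<^bsub>W\<^esub> f y"
    and "c \<in> carrier K \<Longrightarrow> x \<in> carrier V \<Longrightarrow> f (c \<odot>\<^bsub>V\<^esub> x) = c \<odot>\<^bsub>W\<^esub> f x"
  using assms by (auto simp: linear_map_def)

lemma linear_mapI:
  assumes "\<And>x. x \<in> carrier V \<Longrightarrow> f x \<in> carrier W"
    and "\<And>x y. x \<in> carrier V \<Longrightarrow> y \<in> carrier V \<Longrightarrow> f (x \<oplus>\<^bsub>V\<^esub> y) = f x \<oplus>\<^bsub>W\<^esub> f y"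
    and "\<And>c x. c \<in> carrier K \<Longrightarrow> x \<in> carrier V \<Longrightarrow> f (c \<odot>\<^bsub>V\<^esub> x) = c \<odot>\<^bsub>W\<^esub> f x"
  shows "linear_map K V W f"
  using assms by (auto simp: linear_map_def)

lemma linear_map_compose:
  assumes "linear_map K U V f" "linear_map K V W g"
  shows "linear_map K U W (\<lambda>x. g (f x))"
  using assms by (intro linear_mapI) (simp_all add: linear_mapD[OF assms(1)] linear_mapD[OF assms(2)])

lemma linear_map_zero:
  assumes "module K V" "module K W" "linear_map K V W f"
  shows "f \<zero>\<^bsub>V\<^esub> = \<zero>\<^bsub>W\<^esub>"
proof -
  interpret V: module K V by fact
  interpret W: module K W by fact
  have "f (\<zero>\<^bsub>K\<^esub> \<odot>\<^bsub>V\<^esub> \<zero>\<^bsub>V\<^esub>) = \<zero>\<^bsub>K\<^esub> \<odot>\<^bsub>W\<^esub> f \<zero>\<^bsub>V\<^esub>"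
    by (intro linear_mapD(3)[OF assms(3)]) auto
  then show ?thesis
    using linear_mapD(1)[OF assms(3)] by simp
qed

lemma algebra_homD:
  assumes "algebra_hom K A B f"
  shows "x \<in> carrier A \<Longrightarrow> f x \<in> carrier B"
    and "x \<in> carrier A \<Longrightarrow> y \<in> carrier A \<Longrightarrow> f (x \<oplus>\<^bsub>A\<^esub> y) = f x \<oplus>\<^bsub>B\<^esub> f y"
    and "x \<in> carrier A \<Longrightarrow> y \<in> carrier A \<Longrightarrow> f (x \<otimes>\<^bsub>A\<^esub> y) = f x \<otimes>\<^bsub>B\<^esub> f y"
    and "c \<in> carrier K \<Longrightarrow> x \<in> carrier A \<Longrightarrow> f (c \<odot>\<^bsub>A\<^esub> x) = c \<odot>\<^bsub>B\<^esub> f x"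
    and "f \<one>\<^bsub>A\<^esub> = \<one>\<^bsub>B\<^esub>"
  using assms by (auto simp: algebra_hom_def linear_map_def ring_hom_def)

lemma algebra_hom_linear: "algebra_hom K A B f \<Longrightarrow> linear_map K A B f"
  by (simp add: algebra_hom_def)

lemma algebra_homI:
  assumes "\<And>x. x \<in> carrier A \<Longrightarrow> f x \<in> carrier B"
    and "\<And>x y. x \<in> carrier A \<Longrightarrow> y \<in> carrier A \<Longrightarrow> f (x \<oplus>\<^bsub>A\<^esub> y) = f x \<oplus>\<^bsub>B\<^esub> f y"
    and "\<And>x y. x \<in> carrier A \<Longrightarrow> y \<in> carrier A \<Longrightarrow> f (x \<otimes>\<^bsub>A\<^esub> y) = f x \<otimes>\<^bsub>B\<^esub> f y"
    and "\<And>c x. c \<in> carrier K \<Longrightarrow> x \<in> carrier A \<Longrightarrow> f (c \<odot>\<^bsub>A\<^esub> x) = c \<odot>\<^bsub>B\<^esub> f x"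
    and "f \<one>\<^bsub>A\<^esub> = \<one>\<^bsub>B\<^esub>"
  shows "algebra_hom K A B f"
  using assms by (auto simp: algebra_hom_def linear_map_def ring_hom_def)

lemma algebra_hom_compose:
  assumes "algebra_hom K A B f" "algebra_hom K B C g"
  shows "algebra_hom K A C (\<lambda>x. g (f x))"
  using assms by (intro algebra_homI) (simp_all add: algebra_homD[OF assms(1)] algebra_homD[OF assms(2)])

lemma algebra_hom_cong:
  assumes "assoc_algebra K A" "algebra_hom K A B f" "\<And>x. x \<in> carrier A \<Longrightarrow> g x = f x"
  shows "algebra_hom K A B g"
proof -
  interpret A: assoc_algebra K A by fact
  show ?thesis
    by (intro algebra_homI) (simp_all add: assms(3) algebra_homD[OF assms(2)])
qed

lemma algebra_hom_minus:
  assumes "assoc_algebra K A" "assoc_algebra K B" "algebra_hom K A B f"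
    and "x \<in> carrier A" "y \<in> carrier A"
  shows "f (x \<ominus>\<^bsub>A\<^esub> y) = f x \<ominus>\<^bsub>B\<^esub> f y"
proof -
  interpret A: assoc_algebra K A by fact
  interpret B: assoc_algebra K B by fact
  interpret ring_hom_ring A B f
    using assms by unfold_locales (auto simp: algebra_hom_def)
  show ?thesis
    using assms by (simp add: A.minus_eq B.minus_eq)
qed

section \<open>The universal property of the free algebra\<close>

text \<open>Evaluation of a noncommutative polynomial at the substitution \<open>h\<close>. The sum
  ranges over the support because \<open>finsum\<close> is meaningful only over finite sets; the
  empty word evaluates to the unit.\<close>

definition free_lift ::
    "('k, 'c) ring_scheme \<Rightarrow> ('k, 'a, 'm) module_scheme \<Rightarrow> ('x \<Rightarrow> 'a) \<Rightarrow> ('x list \<Rightarrow> 'k) \<Rightarrow> 'a"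
  where "free_lift K C h p =
    (\<Oplus>\<^bsub>C\<^esub>w\<in>{w. p w \<noteq> \<zero>\<^bsub>K\<^esub>}. p w \<odot>\<^bsub>C\<^esub> foldr (\<otimes>\<^bsub>C\<^esub>) (map h w) \<one>\<^bsub>C\<^esub>)"

context
  fixes K (structure) and C (structure) and X h
  assumes C: "assoc_algebra K C" and h: "h \<in> X \<rightarrow> carrier C"
begin

interpretation C: assoc_algebra K C
  by (rule C)

interpretation F: assoc_algebra K "free_algebra K X"
  by (rule C.R.free_algebra_assoc_algebra)

lemma word_image_closed: "set w \<subseteq> X \<Longrightarrow> foldr (\<otimes>\<^bsub>C\<^esub>) (map h w) \<one>\<^bsub>C\<^esub> \<in> carrier C"
  using h by (induction w) auto

lemma word_image_append:
  "set u \<subseteq> X \<Longrightarrow> set v \<subseteq> X \<Longrightarrow> foldr (\<otimes>\<^bsub>C\<^esub>) (map h (u @ v)) \<one>\<^bsub>C\<^esub>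
    = foldr (\<otimes>\<^bsub>C\<^esub>) (map h u) \<one>\<^bsub>C\<^esub> \<otimes>\<^bsub>C\<^esub> foldr (\<otimes>\<^bsub>C\<^esub>) (map h v) \<one>\<^bsub>C\<^esub>"
proof (induction u)
  case Nil
  then show ?case using word_image_closed[of v] by simp
next
  case (Cons x u)
  then show ?case
    using h word_image_closed[of u] word_image_closed[of v] by (simp add: C.m_assoc Pi_def)
qed

text \<open>The added terms have coefficient zero. A larger index set allows sums for different
  polynomials to be compared term by term, although cancellation can make the support of p + q
  smaller than the union of the two supports.\<close>

lemma free_lift_superset:
  assumes p: "p \<in> carrier (free_algebra K X)"
    and S: "finite S" "{w. p w \<noteq> \<zero>\<^bsub>K\<^esub>} \<subseteq> S" "\<And>w. w \<in> S \<Longrightarrow> set w \<subseteq> X"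
  shows "free_lift K C h p = (\<Oplus>\<^bsub>C\<^esub>w\<in>S. p w \<odot>\<^bsub>C\<^esub> foldr (\<otimes>\<^bsub>C\<^esub>) (map h w) \<one>\<^bsub>C\<^esub>)"
  unfolding free_lift_def
  using S C.R.free_algebra_coeff_closed[OF p] word_image_closed
  by (intro C.add.finprod_mono_neutral_cong_left) auto

lemma free_lift_closed:
  assumes "p \<in> carrier (free_algebra K X)"
  shows "free_lift K C h p \<in> carrier C"
  unfolding free_lift_def
  using C.R.free_algebra_coeff_closed[OF assms] C.R.free_algebra_support[OF assms] word_image_closed
  by (intro C.finsum_closed) auto

lemma free_lift_add:
  assumes p: "p \<in> carrier (free_algebra K X)" and q: "q \<in> carrier (free_algebra K X)"
  shows "free_lift K C h (p \<oplus>\<^bsub>free_algebra K X\<^esub> q) = free_lift K C h p \<oplus>\<^bsub>C\<^esub> free_lift K C h q"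
proof -
  let ?r = "p \<oplus>\<^bsub>free_algebra K X\<^esub> q"
  let ?S = "{w. p w \<noteq> \<zero>\<^bsub>K\<^esub>} \<union> {w. q w \<noteq> \<zero>\<^bsub>K\<^esub>}"
  let ?m = "\<lambda>w. foldr (\<otimes>\<^bsub>C\<^esub>) (map h w) \<one>\<^bsub>C\<^esub>"
  have r: "?r \<in> carrier (free_algebra K X)"
    using p q by simp
  have fin: "finite ?S"
    using p q by (simp add: free_algebra_simps)
  have supp: "set w \<subseteq> X" if "w \<in> ?S" for w
    using that C.R.free_algebra_support p q by blast
  note lift = free_lift_superset[OF _ fin _ supp]
  note coeff [simp] = p[THEN C.R.free_algebra_coeff_closed] q[THEN C.R.free_algebra_coeff_closed]
  have m [simp]: "?m w \<in> carrier C" if "w \<in> ?S" for w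
    using supp[OF that] by (rule word_image_closed)
  have "free_lift K C h ?r = (\<Oplus>\<^bsub>C\<^esub>w\<in>?S. ?r w \<odot>\<^bsub>C\<^esub> ?m w)"
    by (intro lift r) (auto simp: free_algebra_simps)
  also have "\<dots> = (\<Oplus>\<^bsub>C\<^esub>w\<in>?S. p w \<odot>\<^bsub>C\<^esub> ?m w \<oplus>\<^bsub>C\<^esub> q w \<odot>\<^bsub>C\<^esub> ?m w)"
    by (intro C.finsum_cong') (auto simp: free_algebra_simps C.smult_l_distr)
  also have "\<dots> = (\<Oplus>\<^bsub>C\<^esub>w\<in>?S. p w \<odot>\<^bsub>C\<^esub> ?m w) \<oplus>\<^bsub>C\<^esub> (\<Oplus>\<^bsub>C\<^esub>w\<in>?S. q w \<odot>\<^bsub>C\<^esub> ?m w)"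
    by (intro C.finsum_addf) auto
  also have "(\<Oplus>\<^bsub>C\<^esub>w\<in>?S. p w \<odot>\<^bsub>C\<^esub> ?m w) = free_lift K C h p"
    by (intro lift[symmetric] p) auto
  also have "(\<Oplus>\<^bsub>C\<^esub>w\<in>?S. q w \<odot>\<^bsub>C\<^esub> ?m w) = free_lift K C h q"
    by (intro lift[symmetric] q) auto
  finally show ?thesis .
qed

lemma free_lift_smult:
  assumes c: "c \<in> carrier K" and p: "p \<in> carrier (free_algebra K X)"
  shows "free_lift K C h (c \<odot>\<^bsub>free_algebra K X\<^esub> p) = c \<odot>\<^bsub>C\<^esub> free_lift K C h p"
proof -
  let ?r = "c \<odot>\<^bsub>free_algebra K X\<^esub> p"
  let ?S = "{w. p w \<noteq> \<zero>\<^bsub>K\<^esub>}"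
  let ?m = "\<lambda>w. foldr (\<otimes>\<^bsub>C\<^esub>) (map h w) \<one>\<^bsub>C\<^esub>"
  have fin: "finite ?S"
    using p by (simp add: free_algebra_simps)
  note coeff [simp] = p[THEN C.R.free_algebra_coeff_closed]
  have m [simp]: "?m w \<in> carrier C" if "w \<in> ?S" for w
    using that C.R.free_algebra_support[OF p] by (intro word_image_closed) auto
  have "free_lift K C h ?r = (\<Oplus>\<^bsub>C\<^esub>w\<in>?S. ?r w \<odot>\<^bsub>C\<^esub> ?m w)"
    using c p C.R.free_algebra_support[OF p] F.smult_closed[OF c p]
    by (intro free_lift_superset fin) (auto simp: free_algebra_simps(6))
  also have "\<dots> = (\<Oplus>\<^bsub>C\<^esub>w\<in>?S. c \<odot>\<^bsub>C\<^esub> (p w \<odot>\<^bsub>C\<^esub> ?m w))"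
    using c by (intro C.finsum_cong') (auto simp: free_algebra_simps C.smult_assoc1)
  also have "\<dots> = c \<odot>\<^bsub>C\<^esub> free_lift K C h p"
    unfolding free_lift_def using c fin by (intro C.finsum_smult_ldistr[symmetric]) auto
  finally show ?thesis .
qed

lemma free_lift_word:
  assumes "set w \<subseteq> X"
  shows "free_lift K C h (free_word K w) = foldr (\<otimes>\<^bsub>C\<^esub>) (map h w) \<one>\<^bsub>C\<^esub>"
proof -
  have "free_lift K C h (free_word K w)
      = (\<Oplus>\<^bsub>C\<^esub>v\<in>{w}. free_word K w v \<odot>\<^bsub>C\<^esub> foldr (\<otimes>\<^bsub>C\<^esub>) (map h v) \<one>\<^bsub>C\<^esub>)"
    using assms by (intro free_lift_superset C.R.free_word_closed) (auto simp: free_word_def)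
  then show ?thesis
    using word_image_closed[OF assms] by (simp add: free_word_def)
qed

text \<open>Both sides are bilinear, so two nested span inductions, over \<open>p\<close> and then
  over \<open>q\<close>, leave a pair of words. On words the claim is that evaluation turns
  concatenation into multiplication.\<close>

lemma free_lift_mult:
  assumes "p \<in> carrier (free_algebra K X)" "q \<in> carrier (free_algebra K X)"
  shows "free_lift K C h (p \<otimes>\<^bsub>free_algebra K X\<^esub> q) = free_lift K C h p \<otimes>\<^bsub>C\<^esub> free_lift K C h q"
  using assms(1)
proof (induction rule: C.R.free_algebra_span_induct)
  case zero
  have "free_lift K C h \<zero>\<^bsub>free_algebra K X\<^esub> = \<zero>\<^bsub>C\<^esub>"
    by (simp add: free_lift_def free_algebra_simps)
  then show ?case
    using assms(2) free_lift_closed[OF assms(2)] by simp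
next
  case (add p1 p2)
  then show ?case
    using assms(2) by (simp add: F.l_distr free_lift_add free_lift_closed C.l_distr)
next
  case (smult_word c u)
  note u = C.R.free_word_closed[OF smult_word(2)]
  have "free_lift K C h (free_word K u \<otimes>\<^bsub>free_algebra K X\<^esub> q)
      = free_lift K C h (free_word K u) \<otimes>\<^bsub>C\<^esub> free_lift K C h q"
    using assms(2)
  proof (induction rule: C.R.free_algebra_span_induct)
    case zero
    have "free_lift K C h \<zero>\<^bsub>free_algebra K X\<^esub> = \<zero>\<^bsub>C\<^esub>"
      by (simp add: free_lift_def free_algebra_simps)
    then show ?case
      using u free_lift_closed[OF u] by simp
  next
    case (add q1 q2)
    then show ?case
      using u by (simp add: F.r_distr free_lift_add free_lift_closed C.r_distr)
  next
    case (smult_word c v)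
    note v = C.R.free_word_closed[OF smult_word(2)]
    have "free_lift K C h (free_word K (u @ v))
        = free_lift K C h (free_word K u) \<otimes>\<^bsub>C\<^esub> free_lift K C h (free_word K v)"
      using smult_word(2) \<open>set u \<subseteq> X\<close>
      by (simp add: free_lift_word word_image_append del: map_append foldr_append)
    moreover have "free_word K (u @ v) \<in> carrier (free_algebra K X)"
      using smult_word(2) \<open>set u \<subseteq> X\<close> by (intro C.R.free_word_closed) simp
    ultimately show ?case
      using smult_word(1) u v
      by (simp add: F.smult_mult_right C.smult_mult_right free_lift_smult free_lift_closed
          C.R.free_word_mult)
  qed
  then show ?case
    using smult_word(1) u assms(2)
    by (simp add: F.smult_mult_left C.smult_mult_left free_lift_smult free_lift_closed)
qed

lemma free_lift_algebra_hom: "algebra_hom K (free_algebra K X) C (free_lift K C h)"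
  using free_lift_word[of "[]"]
  by (intro algebra_homI free_lift_closed free_lift_add free_lift_mult free_lift_smult)
    (simp_all add: free_algebra_simps(3))

lemma free_lift_gen: "x \<in> X \<Longrightarrow> free_lift K C h (free_gen K x) = h x"
  using free_lift_word[of "[x]"] h by (simp add: free_gen_eq_free_word Pi_iff)

end

lemma (in cring) free_gen_closed: "x \<in> X \<Longrightarrow> free_gen R x \<in> carrier (free_algebra R X)"
  by (simp add: free_gen_eq_free_word free_word_closed)

text \<open>Agreement passes from generators to words by multiplicativity, and from words to their
  span by linearity.\<close>

lemma free_algebra_hom_unique:
  assumes C: "assoc_algebra K C"
    and \<phi>: "algebra_hom K (free_algebra K X) C \<phi>" and \<psi>: "algebra_hom K (free_algebra K X) C \<psi>"
    and gen: "\<And>x. x \<in> X \<Longrightarrow> \<phi> (free_gen K x) = \<psi> (free_gen K x)"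
    and "p \<in> carrier (free_algebra K X)"
  shows "\<phi> p = \<psi> p"
proof -
  interpret C: assoc_algebra K C by fact
  interpret F: assoc_algebra K "free_algebra K X"
    by (rule C.R.free_algebra_assoc_algebra)
  have word: "\<phi> (free_word K w) = \<psi> (free_word K w)" if "set w \<subseteq> X" for w
    using that
  proof (induction w)
    case Nil
    then show ?case
      using algebra_homD(5)[OF \<phi>] algebra_homD(5)[OF \<psi>] by (simp add: free_algebra_simps)
  next
    case (Cons x w)
    have "free_word K (x # w) = free_gen K x \<otimes>\<^bsub>free_algebra K X\<^esub> free_word K w"
      by (simp add: free_gen_eq_free_word C.R.free_word_mult)
    with Cons show ?case
      by (simp add: algebra_homD(3)[OF \<phi>] algebra_homD(3)[OF \<psi>] gen C.R.free_gen_closed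
          C.R.free_word_closed)
  qed
  show ?thesis
    using assms(5)
  proof (induction rule: C.R.free_algebra_span_induct)
    case zero
    show ?case
      using linear_map_zero[OF F.module_axioms C.module_axioms algebra_hom_linear[OF \<phi>]]
        linear_map_zero[OF F.module_axioms C.module_axioms algebra_hom_linear[OF \<psi>]] by simp
  next
    case (add p q)
    then show ?case
      by (simp add: algebra_homD(2)[OF \<phi>] algebra_homD(2)[OF \<psi>])
  next
    case (smult_word c w)
    then show ?case
      by (simp add: algebra_homD(4)[OF \<phi>] algebra_homD(4)[OF \<psi>] word C.R.free_word_closed)
  qed
qed

lemma (in abelian_group) minus_eq_zero_iff:
  "x \<in> carrier G \<Longrightarrow> y \<in> carrier G \<Longrightarrow> x \<ominus> y = \<zero> \<longleftrightarrow> x = y"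
  by (metis a_inv_closed minus_eq minus_equality minus_minus r_neg)

section \<open>Quotient algebras\<close>

lemma quot_algebra_simps:
  "carrier (quot_algebra T S) = quot_class T S ` carrier T"
  "X \<otimes>\<^bsub>quot_algebra T S\<^esub> Y = X \<otimes>\<^bsub>T Quot (Idl\<^bsub>T\<^esub> S)\<^esub> Y"
  "\<one>\<^bsub>quot_algebra T S\<^esub> = quot_class T S \<one>\<^bsub>T\<^esub>"
  "\<zero>\<^bsub>quot_algebra T S\<^esub> = Idl\<^bsub>T\<^esub> S"
  "X \<oplus>\<^bsub>quot_algebra T S\<^esub> Y = X \<oplus>\<^bsub>T Quot (Idl\<^bsub>T\<^esub> S)\<^esub> Y"
  "c \<odot>\<^bsub>quot_algebra T S\<^esub> X = (\<Union>x\<in>X. quot_class T S (c \<odot>\<^bsub>T\<^esub> x))"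
  by (auto simp: quot_algebra_def quot_class_def ring.defs FactRing_def A_RCOSETS_def RCOSETS_def
      a_r_coset_def)

context assoc_algebra
begin

context
  fixes S assumes S: "S \<subseteq> carrier A"
begin

interpretation I: ideal "Idl\<^bsub>A\<^esub> S" A
  using S by (rule A.genideal_ideal)

text \<open>The ideal is generated in the ring alone, yet it absorbs scalars because cx =
  (c1)x.\<close>

lemma Idl_smult_closed: "c \<in> carrier K \<Longrightarrow> x \<in> Idl\<^bsub>A\<^esub> S \<Longrightarrow> c \<odot>\<^bsub>A\<^esub> x \<in> Idl\<^bsub>A\<^esub> S"
  using I.I_l_closed[of x "c \<odot>\<^bsub>A\<^esub> \<one>\<^bsub>A\<^esub>"] I.Icarr[of x] smult_mult_left[of c "\<one>\<^bsub>A\<^esub>" x] by simp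

text \<open>On cosets the scalar product is a union over all representatives. Its members are all
  the same coset, and \<open>x\<close> itself makes the union nonempty.\<close>

lemma quot_class_smult:
  assumes c: "c \<in> carrier K" and x: "x \<in> carrier A"
  shows "quot_class A S (c \<odot>\<^bsub>A\<^esub> x) = c \<odot>\<^bsub>quot_algebra A S\<^esub> quot_class A S x"
proof -
  have "quot_class A S (c \<odot>\<^bsub>A\<^esub> y) = quot_class A S (c \<odot>\<^bsub>A\<^esub> x)" if y: "y \<in> quot_class A S x" for y
  proof -
    obtain i where i: "i \<in> Idl\<^bsub>A\<^esub> S" "y = i \<oplus>\<^bsub>A\<^esub> x"
      using y unfolding quot_class_def a_r_coset_def' by blast
    then have "c \<odot>\<^bsub>A\<^esub> y = c \<odot>\<^bsub>A\<^esub> i \<oplus>\<^bsub>A\<^esub> c \<odot>\<^bsub>A\<^esub> x"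
      using c x I.Icarr by (simp add: smult_r_distr)
    then have "c \<odot>\<^bsub>A\<^esub> y \<in> Idl\<^bsub>A\<^esub> S +>\<^bsub>A\<^esub> (c \<odot>\<^bsub>A\<^esub> x)"
      using c i Idl_smult_closed by (auto simp: a_r_coset_def')
    then show ?thesis
      using c x by (simp add: quot_class_def I.a_repr_independence')
  qed
  moreover have "x \<in> quot_class A S x"
    using x by (simp add: quot_class_def I.a_rcos_self)
  ultimately show ?thesis
    unfolding quot_algebra_simps(6) by (intro SUP_eq_const[symmetric]) blast+
qed

lemma quot_class_add:
  "x \<in> carrier A \<Longrightarrow> y \<in> carrier A \<Longrightarrow>
    quot_class A S (x \<oplus>\<^bsub>A\<^esub> y) = quot_class A S x \<oplus>\<^bsub>quot_algebra A S\<^esub> quot_class A S y"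
  by (simp add: quot_algebra_simps quot_class_def ring_hom_add[OF I.rcos_ring_hom])

lemma quot_class_mult:
  "x \<in> carrier A \<Longrightarrow> y \<in> carrier A \<Longrightarrow>
    quot_class A S (x \<otimes>\<^bsub>A\<^esub> y) = quot_class A S x \<otimes>\<^bsub>quot_algebra A S\<^esub> quot_class A S y"
  by (simp add: quot_algebra_simps quot_class_def ring_hom_mult[OF I.rcos_ring_hom])

lemma quot_algebra_ring: "ring (quot_algebra A S)"
proof -
  have eqs:
    "carrier (quot_algebra A S) = carrier (A Quot (Idl\<^bsub>A\<^esub> S))"
    "monoid.mult (quot_algebra A S) = monoid.mult (A Quot (Idl\<^bsub>A\<^esub> S))"
    "\<one>\<^bsub>quot_algebra A S\<^esub> = \<one>\<^bsub>A Quot (Idl\<^bsub>A\<^esub> S)\<^esub>"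
    "ring.add (quot_algebra A S) = ring.add (A Quot (Idl\<^bsub>A\<^esub> S))"
    "\<zero>\<^bsub>quot_algebra A S\<^esub> = \<zero>\<^bsub>A Quot (Idl\<^bsub>A\<^esub> S)\<^esub>"
    by (simp_all add: quot_algebra_def ring.defs)
  interpret Q: ring "A Quot (Idl\<^bsub>A\<^esub> S)"
    by (rule I.quotient_is_ring)
  \<comment> \<open>Negatives are transferred as an existence statement, since \<open>a_inv\<close>
    is defined from the whole record and the two records differ.\<close>
  have "\<exists>y\<in>carrier (A Quot (Idl\<^bsub>A\<^esub> S)). y \<oplus>\<^bsub>A Quot (Idl\<^bsub>A\<^esub> S)\<^esub> x = \<zero>\<^bsub>A Quot (Idl\<^bsub>A\<^esub> S)\<^esub>"
    if "x \<in> carrier (A Quot (Idl\<^bsub>A\<^esub> S))" for x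
    using that Q.a_inv_closed Q.l_neg by blast
  then show ?thesis
    by (intro ringI abelian_groupI monoidI)
      (simp_all only: eqs Q.ring_simprules Q.r_one)
qed

lemma quot_assoc_algebra: "assoc_algebra K (quot_algebra A S)"
proof -
  interpret Q: ring "quot_algebra A S"
    by (rule quot_algebra_ring)
  note hom = quot_class_smult[symmetric] quot_class_add[symmetric] quot_class_mult[symmetric]
  have "module K (quot_algebra A S)"
    by (rule moduleI[OF R.is_cring Q.is_abelian_group])
      (auto simp: quot_algebra_simps(1) hom smult_l_distr smult_r_distr smult_assoc1)
  moreover have "assoc_algebra_axioms K (quot_algebra A S)"
    by (rule assoc_algebra_axioms.intro)
      (auto simp: quot_algebra_simps(1) hom smult_mult_left smult_mult_right)
  ultimately show ?thesis
    using Q.ring_axioms by (intro assoc_algebra.intro)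
qed

lemma quot_class_hom: "algebra_hom K A (quot_algebra A S) (quot_class A S)"
  by (rule algebra_homI)
    (simp_all add: quot_class_smult quot_class_add quot_class_mult quot_algebra_simps(1,3))

lemma quot_class_eq_zero: "s \<in> S \<Longrightarrow> quot_class A S s = \<zero>\<^bsub>quot_algebra A S\<^esub>"
  using A.genideal_self[OF S] by (auto simp: quot_algebra_simps quot_class_def I.a_rcos_const)

lemma quot_class_eq:
  assumes "x \<in> carrier A" "y \<in> carrier A" "x \<ominus>\<^bsub>A\<^esub> y \<in> S"
  shows "quot_class A S x = quot_class A S y"
proof -
  interpret Q: assoc_algebra K "quot_algebra A S"
    by (rule quot_assoc_algebra)
  have "quot_class A S x \<ominus>\<^bsub>quot_algebra A S\<^esub> quot_class A S y = \<zero>\<^bsub>quot_algebra A S\<^esub>"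
    using algebra_hom_minus[OF assoc_algebra_axioms quot_assoc_algebra quot_class_hom assms(1,2)]
      quot_class_eq_zero[OF assms(3)] by simp
  then show ?thesis
    using assms by (simp add: Q.minus_eq_zero_iff quot_algebra_simps(1))
qed

text \<open>The kernel of \<open>f\<close> is an ideal containing \<open>S\<close>, hence it
  contains the ideal generated by \<open>S\<close>, and \<open>f\<close> is constant on each
  coset.\<close>

lemma quot_algebra_lift:
  assumes C: "assoc_algebra K C" and f: "algebra_hom K A C f"
    and S0: "\<And>s. s \<in> S \<Longrightarrow> f s = \<zero>\<^bsub>C\<^esub>"
  shows "\<exists>\<phi>. algebra_hom K (quot_algebra A S) C \<phi> \<and> (\<forall>x\<in>carrier A. \<phi> (quot_class A S x) = f x)"
proof -
  interpret C: assoc_algebra K C by fact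
  have "f \<in> ring_hom A C"
    using f by (simp add: algebra_hom_def)
  then have "ring_hom_ring A C f"
    by (rule ring_hom_ringI2[OF A.ring_axioms C.A.ring_axioms])
  then have ideal: "ideal (a_kernel A C f) A"
    by (rule ring_hom_ring.kernel_is_ideal)
  have "S \<subseteq> a_kernel A C f"
    using S S0 by (auto simp: a_kernel_def')
  then have kernel: "Idl\<^bsub>A\<^esub> S \<subseteq> a_kernel A C f"
    by (intro A.genideal_minimal ideal)
  \<comment> \<open>The image of a coset under \<open>f\<close> is a singleton, so
    \<open>the_elem\<close> returns the common value without a choice of representative.\<close>
  define \<phi> where "\<phi> X = the_elem (f ` X)" for X
  have \<phi>: "\<phi> (quot_class A S x) = f x" if x: "x \<in> carrier A" for x
  proof -
    have "f y = f x" if y: "y \<in> quot_class A S x" for y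
    proof -
      obtain i where "i \<in> Idl\<^bsub>A\<^esub> S" "y = i \<oplus>\<^bsub>A\<^esub> x"
        using y unfolding quot_class_def a_r_coset_def' by blast
      moreover from this have "i \<in> carrier A" "f i = \<zero>\<^bsub>C\<^esub>"
        using kernel by (auto simp: a_kernel_def')
      ultimately show ?thesis
        using x by (simp add: algebra_homD[OF f])
    qed
    moreover have "x \<in> quot_class A S x"
      using x by (simp add: quot_class_def I.a_rcos_self)
    ultimately have "f ` quot_class A S x = {f x}"
      by blast
    then show ?thesis by (simp add: \<phi>_def)
  qed
  have "algebra_hom K (quot_algebra A S) C \<phi>"
    by (rule algebra_homI)
      (auto simp: quot_algebra_simps(1,3) quot_class_add[symmetric] quot_class_mult[symmetric]
        quot_class_smult[symmetric] \<phi> algebra_homD[OF f])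
  with \<phi> show ?thesis by blast
qed

end

end

section \<open>The universal property of the tensor algebra\<close>

text \<open>The closure under which both sides of every tensor relation lie in the free algebra. For
  the direct sum it is immediate and stands in for a proof that the direct sum is a module.\<close>

definition add_smult_closed :: "('k, 'c) ring_scheme \<Rightarrow> ('k, 'v, 'm) module_scheme \<Rightarrow> bool"
  where "add_smult_closed K V \<longleftrightarrow>
    (\<forall>x\<in>carrier V. \<forall>y\<in>carrier V. x \<oplus>\<^bsub>V\<^esub> y \<in> carrier V) \<and>
    (\<forall>c\<in>carrier K. \<forall>x\<in>carrier V. c \<odot>\<^bsub>V\<^esub> x \<in> carrier V)"

context
  fixes K (structure) and V (structure)
  assumes K: "cring K" and V: "add_smult_closed K V"
begin

interpretation K: cring K
  by (rule K)

interpretation F: assoc_algebra K "free_algebra K (carrier V)"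
  by (rule K.free_algebra_assoc_algebra)

lemma tensor_rels_subset: "tensor_rels K V \<subseteq> carrier (free_algebra K (carrier V))"
  using V by (auto simp: tensor_rels_def Let_def add_smult_closed_def K.free_gen_closed)

lemma tensor_assoc_algebra: "assoc_algebra K (tensor_algebra K V)"
  unfolding tensor_algebra_def by (rule F.quot_assoc_algebra[OF tensor_rels_subset])

lemma tensor_inj_linear: "linear_map K V (tensor_algebra K V) (tensor_inj K V)"
proof (rule linear_mapI)
  let ?F = "free_algebra K (carrier V)" and ?R = "tensor_rels K V"
  note hom = algebra_homD[OF F.quot_class_hom[OF tensor_rels_subset]]
  note eq = F.quot_class_eq[OF tensor_rels_subset]
  note gen [simp] = K.free_gen_closed
  show "tensor_inj K V x \<in> carrier (tensor_algebra K V)" if "x \<in> carrier V" for x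
    unfolding tensor_algebra_def tensor_inj_def using that by (intro hom(1)) simp
  fix x assume x: "x \<in> carrier V"
  show "tensor_inj K V (x \<oplus>\<^bsub>V\<^esub> y)
      = tensor_inj K V x \<oplus>\<^bsub>tensor_algebra K V\<^esub> tensor_inj K V y" if y: "y \<in> carrier V" for y
  proof -
    have xy: "x \<oplus>\<^bsub>V\<^esub> y \<in> carrier V"
      using x y V by (simp add: add_smult_closed_def)
    have "quot_class ?F ?R (free_gen K (x \<oplus>\<^bsub>V\<^esub> y))
        = quot_class ?F ?R (free_gen K x \<oplus>\<^bsub>?F\<^esub> free_gen K y)"
    proof (rule eq)
      show "free_gen K (x \<oplus>\<^bsub>V\<^esub> y) \<ominus>\<^bsub>?F\<^esub> (free_gen K x \<oplus>\<^bsub>?F\<^esub> free_gen K y) \<in> ?R"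
        unfolding tensor_rels_def Let_def using x y by blast
    qed (use x y xy in auto)
    also have "\<dots> = quot_class ?F ?R (free_gen K x) \<oplus>\<^bsub>quot_algebra ?F ?R\<^esub> quot_class ?F ?R (free_gen K y)"
      using x y by (intro hom(2)) auto
    finally show ?thesis
      by (simp only: tensor_algebra_def tensor_inj_def)
  qed
  show "tensor_inj K V (c \<odot>\<^bsub>V\<^esub> x) = c \<odot>\<^bsub>tensor_algebra K V\<^esub> tensor_inj K V x"
    if c: "c \<in> carrier K" for c
  proof -
    have cx: "c \<odot>\<^bsub>V\<^esub> x \<in> carrier V"
      using x c V by (simp add: add_smult_closed_def)
    have "quot_class ?F ?R (free_gen K (c \<odot>\<^bsub>V\<^esub> x)) = quot_class ?F ?R (c \<odot>\<^bsub>?F\<^esub> free_gen K x)"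
    proof (rule eq)
      show "free_gen K (c \<odot>\<^bsub>V\<^esub> x) \<ominus>\<^bsub>?F\<^esub> c \<odot>\<^bsub>?F\<^esub> free_gen K x \<in> ?R"
        unfolding tensor_rels_def Let_def using x c by blast
    qed (use x c cx in auto)
    also have "\<dots> = c \<odot>\<^bsub>quot_algebra ?F ?R\<^esub> quot_class ?F ?R (free_gen K x)"
      using x c by (intro hom(4)) auto
    finally show ?thesis
      by (simp only: tensor_algebra_def tensor_inj_def)
  qed
qed

text \<open>Linearity of \<open>h\<close> makes evaluation at \<open>h\<close> kill the tensor
  relations, so evaluation descends to the quotient.\<close>

lemma tensor_lift:
  assumes C: "assoc_algebra K C" and h: "linear_map K V C h"
  shows "\<exists>\<phi>. algebra_hom K (tensor_algebra K V) C \<phi> \<and> (\<forall>v\<in>carrier V. \<phi> (tensor_inj K V v) = h v)"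
proof -
  interpret C: assoc_algebra K C by fact
  have hV: "h \<in> carrier V \<rightarrow> carrier C"
    using h by (simp add: linear_map_def)
  note hom = free_lift_algebra_hom[OF C hV]
  note simps = algebra_hom_minus[OF F.assoc_algebra_axioms C hom] algebra_homD[OF hom]
    free_lift_gen[OF C hV] K.free_gen_closed linear_mapD[OF h]
  have "free_lift K C h s = \<zero>\<^bsub>C\<^esub>" if "s \<in> tensor_rels K V" for s
    using that V
    by (auto simp: tensor_rels_def Let_def add_smult_closed_def simps C.minus_eq_zero_iff)
  from F.quot_algebra_lift[OF tensor_rels_subset C hom this] obtain \<phi>
    where \<phi>: "algebra_hom K (tensor_algebra K V) C \<phi>"
      "\<And>p. p \<in> carrier (free_algebra K (carrier V)) \<Longrightarrow>
        \<phi> (quot_class (free_algebra K (carrier V)) (tensor_rels K V) p) = free_lift K C h p"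
    unfolding tensor_algebra_def by blast
  have "\<forall>v\<in>carrier V. \<phi> (tensor_inj K V v) = h v"
    by (simp add: tensor_inj_def \<phi>(2) simps)
  with \<phi>(1) show ?thesis by blast
qed

lemma tensor_hom_unique:
  assumes C: "assoc_algebra K C"
    and \<phi>: "algebra_hom K (tensor_algebra K V) C \<phi>" and \<psi>: "algebra_hom K (tensor_algebra K V) C \<psi>"
    and gen: "\<And>v. v \<in> carrier V \<Longrightarrow> \<phi> (tensor_inj K V v) = \<psi> (tensor_inj K V v)"
    and x: "x \<in> carrier (tensor_algebra K V)"
  shows "\<phi> x = \<psi> x"
proof -
  note q = F.quot_class_hom[OF tensor_rels_subset]
  obtain p where p: "p \<in> carrier (free_algebra K (carrier V))"
    and x: "x = quot_class (free_algebra K (carrier V)) (tensor_rels K V) p"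
    using x by (auto simp: tensor_algebra_def quot_algebra_simps)
  have "\<phi> (quot_class (free_algebra K (carrier V)) (tensor_rels K V) p)
      = \<psi> (quot_class (free_algebra K (carrier V)) (tensor_rels K V) p)"
  proof (rule free_algebra_hom_unique[OF C _ _ _ p])
    show "algebra_hom K (free_algebra K (carrier V)) C
        (\<lambda>p. \<phi> (quot_class (free_algebra K (carrier V)) (tensor_rels K V) p))"
      using \<phi> unfolding tensor_algebra_def by (rule algebra_hom_compose[OF q])
    show "algebra_hom K (free_algebra K (carrier V)) C
        (\<lambda>p. \<psi> (quot_class (free_algebra K (carrier V)) (tensor_rels K V) p))"
      using \<psi> unfolding tensor_algebra_def by (rule algebra_hom_compose[OF q])
  qed (use gen in \<open>simp add: tensor_inj_def\<close>)
  then show ?thesis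
    by (simp only: x)
qed

end

section \<open>The universal property of the enveloping algebra\<close>

lemma direct_sum_simps:
  "carrier (direct_sum V W) = carrier V \<times> carrier W"
  "(a, b) \<oplus>\<^bsub>direct_sum V W\<^esub> (c, d) = (a \<oplus>\<^bsub>V\<^esub> c, b \<oplus>\<^bsub>W\<^esub> d)"
  "k \<odot>\<^bsub>direct_sum V W\<^esub> (a, b) = (k \<odot>\<^bsub>V\<^esub> a, k \<odot>\<^bsub>W\<^esub> b)"
  by (simp_all add: direct_sum_def RDirProd_def DirProd_def ring.defs monoid.defs)

text \<open>The two commutator relations are written without subtraction, so that they can be checked in
  \<open>C[\<epsilon>]\<close> without computing additive inverses there.\<close>

definition ue_pair ::
    "('k, 'c) ring_scheme \<Rightarrow> ('k, 'a, 'm) module_scheme \<Rightarrow> ('a \<Rightarrow> 'a \<Rightarrow> 'a)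
      \<Rightarrow> ('k, 'b, 'n) module_scheme \<Rightarrow> ('a \<Rightarrow> 'b) \<Rightarrow> ('a \<Rightarrow> 'b) \<Rightarrow> bool"
  where "ue_pair K A br C f g \<longleftrightarrow>
    linear_map K A C f \<and> linear_map K A C g \<and> f \<one>\<^bsub>A\<^esub> = \<one>\<^bsub>C\<^esub> \<and>
    (\<forall>a\<in>carrier A. \<forall>b\<in>carrier A.
      f (a \<otimes>\<^bsub>A\<^esub> b) = f a \<otimes>\<^bsub>C\<^esub> f b \<and>
      g (br a b) \<oplus>\<^bsub>C\<^esub> g b \<otimes>\<^bsub>C\<^esub> g a = g a \<otimes>\<^bsub>C\<^esub> g b \<and>
      f (br a b) \<oplus>\<^bsub>C\<^esub> f b \<otimes>\<^bsub>C\<^esub> g a = g a \<otimes>\<^bsub>C\<^esub> f b \<and>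
      g (a \<otimes>\<^bsub>A\<^esub> b) = f a \<otimes>\<^bsub>C\<^esub> g b \<oplus>\<^bsub>C\<^esub> f b \<otimes>\<^bsub>C\<^esub> g a)"

lemma ue_pairD:
  assumes "ue_pair K A br C f g"
  shows "linear_map K A C f" "linear_map K A C g" "f \<one>\<^bsub>A\<^esub> = \<one>\<^bsub>C\<^esub>"
    and "\<And>a b. a \<in> carrier A \<Longrightarrow> b \<in> carrier A \<Longrightarrow> f (a \<otimes>\<^bsub>A\<^esub> b) = f a \<otimes>\<^bsub>C\<^esub> f b"
    and "\<And>a b. a \<in> carrier A \<Longrightarrow> b \<in> carrier A \<Longrightarrow>
      g (br a b) \<oplus>\<^bsub>C\<^esub> g b \<otimes>\<^bsub>C\<^esub> g a = g a \<otimes>\<^bsub>C\<^esub> g b"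
    and "\<And>a b. a \<in> carrier A \<Longrightarrow> b \<in> carrier A \<Longrightarrow>
      f (br a b) \<oplus>\<^bsub>C\<^esub> f b \<otimes>\<^bsub>C\<^esub> g a = g a \<otimes>\<^bsub>C\<^esub> f b"
    and "\<And>a b. a \<in> carrier A \<Longrightarrow> b \<in> carrier A \<Longrightarrow>
      g (a \<otimes>\<^bsub>A\<^esub> b) = f a \<otimes>\<^bsub>C\<^esub> g b \<oplus>\<^bsub>C\<^esub> f b \<otimes>\<^bsub>C\<^esub> g a"
  using assms by (auto simp: ue_pair_def)

text \<open>Passes between the commutator relations of \<open>ue_rels\<close>, written with a
  difference, and their form in \<open>ue_pair\<close>.\<close>

lemma (in abelian_group) eq_minus_iff:
  assumes "x \<in> carrier G" "y \<in> carrier G" "z \<in> carrier G"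
  shows "x = y \<ominus> z \<longleftrightarrow> x \<oplus> z = y"
  using assms by (metis a_minus_def add.inv_solve_right a_inv_closed)

context
  fixes K (structure) and A (structure) and br
  assumes A: "assoc_algebra K A"
    and br_Pi: "br \<in> carrier A \<rightarrow> carrier A \<rightarrow> carrier A"
begin

interpretation A: assoc_algebra K A
  by (rule A)

lemma br_closed: "a \<in> carrier A \<Longrightarrow> b \<in> carrier A \<Longrightarrow> br a b \<in> carrier A"
  using br_Pi by blast

lemma direct_sum_closed: "add_smult_closed K (direct_sum A A)"
  by (auto simp: add_smult_closed_def direct_sum_simps)

interpretation T: assoc_algebra K "tensor_algebra K (direct_sum A A)"
  by (rule tensor_assoc_algebra[OF A.R.is_cring direct_sum_closed])

lemma pre_M_linear: "linear_map K A (tensor_algebra K (direct_sum A A)) (pre_M K A)"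
proof -
  have "linear_map K A (direct_sum A A) (\<lambda>a. (a, \<zero>\<^bsub>A\<^esub>))"
    by (rule linear_mapI) (simp_all add: direct_sum_simps)
  from linear_map_compose[OF this tensor_inj_linear[OF A.R.is_cring direct_sum_closed]]
  show ?thesis
    by (simp add: pre_M_def[abs_def])
qed

lemma pre_H_linear: "linear_map K A (tensor_algebra K (direct_sum A A)) (pre_H K A)"
proof -
  have "linear_map K A (direct_sum A A) (\<lambda>a. (\<zero>\<^bsub>A\<^esub>, a))"
    by (rule linear_mapI) (simp_all add: direct_sum_simps)
  from linear_map_compose[OF this tensor_inj_linear[OF A.R.is_cring direct_sum_closed]]
  show ?thesis
    by (simp add: pre_H_def[abs_def])
qed

text \<open>By linearity from (a, b) = (a, 0) + (0, b). Homomorphisms that agree on the values of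
  \<open>pre_M\<close> and \<open>pre_H\<close> therefore agree on all generators of the tensor
  algebra.\<close>

lemma tensor_inj_direct_sum:
  assumes "a \<in> carrier A" "b \<in> carrier A"
  shows "tensor_inj K (direct_sum A A) (a, b)
    = pre_M K A a \<oplus>\<^bsub>tensor_algebra K (direct_sum A A)\<^esub> pre_H K A b"
  using linear_mapD(2)[OF tensor_inj_linear[OF A.R.is_cring direct_sum_closed],
      of "(a, \<zero>\<^bsub>A\<^esub>)" "(\<zero>\<^bsub>A\<^esub>, b)"] assms
  by (simp add: pre_M_def pre_H_def direct_sum_simps)

lemmas pre_closed = linear_mapD(1)[OF pre_M_linear] linear_mapD(1)[OF pre_H_linear]

lemma ue_rels_subset: "ue_rels K A br \<subseteq> carrier (tensor_algebra K (direct_sum A A))"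
  unfolding ue_rels_def Let_def by (auto simp: pre_closed br_closed)

lemma ue_assoc_algebra: "assoc_algebra K (ue K A br)"
  unfolding ue_def by (rule T.quot_assoc_algebra[OF ue_rels_subset])

interpretation U: assoc_algebra K "ue K A br"
  by (rule ue_assoc_algebra)

lemma ue_class_hom:
  "algebra_hom K (tensor_algebra K (direct_sum A A)) (ue K A br)
    (quot_class (tensor_algebra K (direct_sum A A)) (ue_rels K A br))"
  unfolding ue_def by (rule T.quot_class_hom[OF ue_rels_subset])

lemma ue_M_linear: "linear_map K A (ue K A br) (ue_M K A br)"
  using linear_map_compose[OF pre_M_linear algebra_hom_linear[OF ue_class_hom]]
  by (simp add: ue_M_def[abs_def])

lemma ue_H_linear: "linear_map K A (ue K A br) (ue_H K A br)"
  using linear_map_compose[OF pre_H_linear algebra_hom_linear[OF ue_class_hom]]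
  by (simp add: ue_H_def[abs_def])

lemmas ue_closed = linear_mapD(1)[OF ue_M_linear] linear_mapD(1)[OF ue_H_linear]

text \<open>Each clause of \<open>ue_pair\<close> is one family of \<open>ue_rels\<close> read in
  the quotient. Together with \<open>ue_lift\<close> this makes the pair universal.\<close>

lemma ue_pair_ue: "ue_pair K A br (ue K A br) (ue_M K A br) (ue_H K A br)"
proof -
  let ?T = "tensor_algebra K (direct_sum A A)" and ?R = "ue_rels K A br"
  let ?M = "pre_M K A" and ?H = "pre_H K A"
  note eq = T.quot_class_eq[OF ue_rels_subset]
  note hom = algebra_homD[OF ue_class_hom]
    algebra_hom_minus[OF T.assoc_algebra_axioms U.assoc_algebra_axioms ue_class_hom]
  have one: "quot_class ?T ?R (?M \<one>\<^bsub>A\<^esub>) = quot_class ?T ?R \<one>\<^bsub>?T\<^esub>"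
    by (rule eq) (simp_all add: pre_closed, simp add: ue_rels_def Let_def)
  have rels:
    "quot_class ?T ?R (?M (a \<otimes>\<^bsub>A\<^esub> b)) = quot_class ?T ?R (?M a \<otimes>\<^bsub>?T\<^esub> ?M b)"
    "quot_class ?T ?R (?H (br a b)) = quot_class ?T ?R (?H a \<otimes>\<^bsub>?T\<^esub> ?H b \<ominus>\<^bsub>?T\<^esub> ?H b \<otimes>\<^bsub>?T\<^esub> ?H a)"
    "quot_class ?T ?R (?M (br a b)) = quot_class ?T ?R (?H a \<otimes>\<^bsub>?T\<^esub> ?M b \<ominus>\<^bsub>?T\<^esub> ?M b \<otimes>\<^bsub>?T\<^esub> ?H a)"
    "quot_class ?T ?R (?H (a \<otimes>\<^bsub>A\<^esub> b)) = quot_class ?T ?R (?M a \<otimes>\<^bsub>?T\<^esub> ?H b \<oplus>\<^bsub>?T\<^esub> ?M b \<otimes>\<^bsub>?T\<^esub> ?H a)"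
    if ab: "a \<in> carrier A" "b \<in> carrier A" for a b
  proof -
    note c = pre_closed[OF ab(1)] pre_closed[OF ab(2)] pre_closed[OF br_closed[OF ab]]
      pre_closed[OF A.m_closed[OF ab]]
    show "quot_class ?T ?R (?M (a \<otimes>\<^bsub>A\<^esub> b)) = quot_class ?T ?R (?M a \<otimes>\<^bsub>?T\<^esub> ?M b)"
      by (rule eq) (simp_all add: c, unfold ue_rels_def Let_def, use ab in blast)
    show "quot_class ?T ?R (?H (br a b)) = quot_class ?T ?R (?H a \<otimes>\<^bsub>?T\<^esub> ?H b \<ominus>\<^bsub>?T\<^esub> ?H b \<otimes>\<^bsub>?T\<^esub> ?H a)"
      by (rule eq) (simp_all add: c, unfold ue_rels_def Let_def, use ab in blast)
    show "quot_class ?T ?R (?M (br a b)) = quot_class ?T ?R (?H a \<otimes>\<^bsub>?T\<^esub> ?M b \<ominus>\<^bsub>?T\<^esub> ?M b \<otimes>\<^bsub>?T\<^esub> ?H a)"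
      by (rule eq) (simp_all add: c, unfold ue_rels_def Let_def, use ab in blast)
    show "quot_class ?T ?R (?H (a \<otimes>\<^bsub>A\<^esub> b)) = quot_class ?T ?R (?M a \<otimes>\<^bsub>?T\<^esub> ?H b \<oplus>\<^bsub>?T\<^esub> ?M b \<otimes>\<^bsub>?T\<^esub> ?H a)"
      by (rule eq) (simp_all add: c, unfold ue_rels_def Let_def, use ab in blast)
  qed
  show ?thesis
    unfolding ue_pair_def
    using one rels
    by (simp add: ue_M_linear ue_H_linear U.eq_minus_iff[symmetric] ue_closed br_closed)
      (simp add: ue_M_def ue_H_def hom pre_closed)
qed

lemma ue_lift:
  assumes C: "assoc_algebra K C" and fg: "ue_pair K A br C f g"
  shows "\<exists>\<phi>. algebra_hom K (ue K A br) C \<phi> \<and>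
    (\<forall>a\<in>carrier A. \<phi> (ue_M K A br a) = f a \<and> \<phi> (ue_H K A br a) = g a)"
proof -
  interpret C: assoc_algebra K C by fact
  let ?T = "tensor_algebra K (direct_sum A A)"
  note fg_lin = linear_mapD[OF ue_pairD(1)[OF fg]] linear_mapD[OF ue_pairD(2)[OF fg]]
  note zero = linear_map_zero[OF A.module_axioms C.module_axioms ue_pairD(1)[OF fg]]
    linear_map_zero[OF A.module_axioms C.module_axioms ue_pairD(2)[OF fg]]
  \<comment> \<open>Linear maps out of a direct sum are sums of linear maps on the summands. This
    one restricts to \<open>f\<close> on (a, 0) and to \<open>g\<close> on (0, a), because linear
    maps preserve zero.\<close>
  have "linear_map K (direct_sum A A) C (\<lambda>(a, b). f a \<oplus>\<^bsub>C\<^esub> g b)"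
    by (rule linear_mapI) (auto simp: direct_sum_simps fg_lin C.a_ac C.smult_r_distr)
  from tensor_lift[OF A.R.is_cring direct_sum_closed C this]
  obtain \<psi> where \<psi>: "algebra_hom K ?T C \<psi>"
    and inj: "\<And>v. v \<in> carrier (direct_sum A A) \<Longrightarrow>
      \<psi> (tensor_inj K (direct_sum A A) v) = (case v of (a, b) \<Rightarrow> f a \<oplus>\<^bsub>C\<^esub> g b)"
    by blast
  have M: "\<psi> (pre_M K A a) = f a" and H: "\<psi> (pre_H K A a) = g a" if "a \<in> carrier A" for a
    using that inj[of "(a, \<zero>\<^bsub>A\<^esub>)"] inj[of "(\<zero>\<^bsub>A\<^esub>, a)"]
    by (simp_all add: pre_M_def pre_H_def direct_sum_simps zero fg_lin)
  note hom = algebra_homD[OF \<psi>] algebra_hom_minus[OF T.assoc_algebra_axioms C \<psi>]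
  have "\<psi> s = \<zero>\<^bsub>C\<^esub>" if "s \<in> ue_rels K A br" for s
    using that unfolding ue_rels_def Let_def
    by (auto simp: hom pre_closed br_closed M H fg_lin ue_pairD(3,4,7)[OF fg] C.minus_eq_zero_iff
        C.eq_minus_iff ue_pairD(5,6)[OF fg])
  from T.quot_algebra_lift[OF ue_rels_subset C \<psi> this]
  obtain \<phi> where "algebra_hom K (ue K A br) C \<phi>"
    and "\<And>x. x \<in> carrier ?T \<Longrightarrow> \<phi> (quot_class ?T (ue_rels K A br) x) = \<psi> x"
    unfolding ue_def by blast
  then show ?thesis
    using pre_closed M H unfolding ue_M_def ue_H_def by metis
qed

text \<open>Every element is a class of the tensor algebra, so precomposing with the class map
  reduces the claim to uniqueness there. All later identities between operators are derived from
  this lemma with \<open>C\<close> a dual number algebra.\<close>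

lemma ue_hom_unique:
  assumes C: "assoc_algebra K C"
    and \<phi>: "algebra_hom K (ue K A br) C \<phi>" and \<psi>: "algebra_hom K (ue K A br) C \<psi>"
    and M: "\<And>a. a \<in> carrier A \<Longrightarrow> \<phi> (ue_M K A br a) = \<psi> (ue_M K A br a)"
    and H: "\<And>a. a \<in> carrier A \<Longrightarrow> \<phi> (ue_H K A br a) = \<psi> (ue_H K A br a)"
    and x: "x \<in> carrier (ue K A br)"
  shows "\<phi> x = \<psi> x"
proof -
  let ?T = "tensor_algebra K (direct_sum A A)" and ?R = "ue_rels K A br"
  obtain t where t: "t \<in> carrier ?T" and x: "x = quot_class ?T ?R t"
    using x by (auto simp: ue_def quot_algebra_simps)
  note \<phi>' = algebra_hom_compose[OF ue_class_hom \<phi>] and \<psi>' = algebra_hom_compose[OF ue_class_hom \<psi>]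
  have "\<phi> (quot_class ?T ?R t) = \<psi> (quot_class ?T ?R t)"
  proof (rule tensor_hom_unique[OF A.R.is_cring direct_sum_closed C \<phi>' \<psi>' _ t])
    fix v assume "v \<in> carrier (direct_sum A A)"
    then obtain a b where v: "v = (a, b)" and ab: "a \<in> carrier A" "b \<in> carrier A"
      by (auto simp: direct_sum_simps)
    show "\<phi> (quot_class ?T ?R (tensor_inj K (direct_sum A A) v))
        = \<psi> (quot_class ?T ?R (tensor_inj K (direct_sum A A) v))"
      using ab M[OF ab(1)] H[OF ab(2)]
      by (simp add: v tensor_inj_direct_sum algebra_homD(2)[OF \<phi>'] algebra_homD(2)[OF \<psi>']
          pre_closed ue_M_def ue_H_def)
  qed
  then show ?thesis
    by (simp only: x)
qed

end

lemma (in module) smult_left_commute: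
  "a \<in> carrier R \<Longrightarrow> b \<in> carrier R \<Longrightarrow> x \<in> carrier M \<Longrightarrow>
    a \<odot>\<^bsub>M\<^esub> (b \<odot>\<^bsub>M\<^esub> x) = b \<odot>\<^bsub>M\<^esub> (a \<odot>\<^bsub>M\<^esub> x)"
  using smult_assoc1[of a b x] smult_assoc1[of b a x] R.m_comm[of a b] by simp

section \<open>Twisted dual numbers\<close>

text \<open>The algebra \<open>C[\<epsilon>]\<close> with \<open>\<epsilon>\<^sup>2 = \<lambda> \<epsilon>\<close>; the pair \<open>(x, y)\<close> stands for \<open>x + \<epsilon> y\<close>.\<close>

definition dual_algebra :: "'k \<Rightarrow> ('k, 'a, 'm) module_scheme \<Rightarrow> ('k, 'a \<times> 'a) module"
  where "dual_algebra lam C =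
    \<lparr>carrier = carrier C \<times> carrier C,
     monoid.mult = (\<lambda>p q. (fst p \<otimes>\<^bsub>C\<^esub> fst q,
        snd p \<otimes>\<^bsub>C\<^esub> fst q \<oplus>\<^bsub>C\<^esub> fst p \<otimes>\<^bsub>C\<^esub> snd q \<oplus>\<^bsub>C\<^esub> lam \<odot>\<^bsub>C\<^esub> (snd p \<otimes>\<^bsub>C\<^esub> snd q))),
     one = (\<one>\<^bsub>C\<^esub>, \<zero>\<^bsub>C\<^esub>),
     ring.zero = (\<zero>\<^bsub>C\<^esub>, \<zero>\<^bsub>C\<^esub>),
     ring.add = (\<lambda>p q. (fst p \<oplus>\<^bsub>C\<^esub> fst q, snd p \<oplus>\<^bsub>C\<^esub> snd q)),
     smult = (\<lambda>c p. (c \<odot>\<^bsub>C\<^esub> fst p, c \<odot>\<^bsub>C\<^esub> snd p))\<rparr>"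

lemma dual_algebra_simps:
  "carrier (dual_algebra lam C) = carrier C \<times> carrier C"
  "(x, y) \<otimes>\<^bsub>dual_algebra lam C\<^esub> (x', y') = (x \<otimes>\<^bsub>C\<^esub> x',
     y \<otimes>\<^bsub>C\<^esub> x' \<oplus>\<^bsub>C\<^esub> x \<otimes>\<^bsub>C\<^esub> y' \<oplus>\<^bsub>C\<^esub> lam \<odot>\<^bsub>C\<^esub> (y \<otimes>\<^bsub>C\<^esub> y'))"
  "\<one>\<^bsub>dual_algebra lam C\<^esub> = (\<one>\<^bsub>C\<^esub>, \<zero>\<^bsub>C\<^esub>)"
  "\<zero>\<^bsub>dual_algebra lam C\<^esub> = (\<zero>\<^bsub>C\<^esub>, \<zero>\<^bsub>C\<^esub>)"
  "(x, y) \<oplus>\<^bsub>dual_algebra lam C\<^esub> (x', y') = (x \<oplus>\<^bsub>C\<^esub> x', y \<oplus>\<^bsub>C\<^esub> y')"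
  "c \<odot>\<^bsub>dual_algebra lam C\<^esub> (x, y) = (c \<odot>\<^bsub>C\<^esub> x, c \<odot>\<^bsub>C\<^esub> y)"
  by (simp_all add: dual_algebra_def)

text \<open>Since \<epsilon> is central and its k-th power is \<epsilon> times the (k-1)-st power of
  \<lambda>, the \<epsilon> part of a triple product is the sum, over the nonempty sets of k factors
  taken in their \<epsilon> part, of that power of \<lambda> times the product. This does not depend
  on the bracketing.\<close>

lemma (in assoc_algebra) dual_assoc_algebra:
  assumes lam: "lam \<in> carrier K"
  shows "assoc_algebra K (dual_algebra lam A)"
proof -
  let ?E = "dual_algebra lam A"
  have group: "abelian_group ?E"
  proof (rule abelian_groupI)
    fix p assume "p \<in> carrier ?E"
    then show "\<exists>q\<in>carrier ?E. q \<oplus>\<^bsub>?E\<^esub> p = \<zero>\<^bsub>?E\<^esub>"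
      by (intro bexI[of _ "(\<ominus>\<^bsub>A\<^esub> fst p, \<ominus>\<^bsub>A\<^esub> snd p)"]) (auto simp: dual_algebra_simps M.l_neg)
  qed (auto simp: dual_algebra_simps M.a_ac)
  note distrib = A.l_distr A.r_distr smult_r_distr smult_mult_left smult_mult_right
  have "Group.monoid ?E"
  proof (rule monoidI)
    fix p q r assume "p \<in> carrier ?E" "q \<in> carrier ?E" "r \<in> carrier ?E"
    then show "(p \<otimes>\<^bsub>?E\<^esub> q) \<otimes>\<^bsub>?E\<^esub> r = p \<otimes>\<^bsub>?E\<^esub> (q \<otimes>\<^bsub>?E\<^esub> r)"
      using lam by (auto simp: dual_algebra_simps distrib A.m_assoc M.a_ac)
  qed (use lam in \<open>auto simp: dual_algebra_simps\<close>)
  then have "ring ?E"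
    by (intro ringI group) (use lam in \<open>auto simp: dual_algebra_simps distrib M.a_ac\<close>)
  moreover have "module K ?E"
    by (rule moduleI[OF R.is_cring group])
      (auto simp: dual_algebra_simps smult_l_distr smult_r_distr smult_assoc1)
  moreover have "assoc_algebra_axioms K ?E"
    by (rule assoc_algebra_axioms.intro)
      (use lam in \<open>auto simp: dual_algebra_simps distrib smult_left_commute\<close>)
  ultimately show ?thesis
    by (intro assoc_algebra.intro)
qed

text \<open>The first coordinates of the homomorphism laws hold trivially; the second coordinates
  are linearity, the value at 1 and the weighted Leibniz rule.\<close>

lemma diff_algebra_iff_dual_hom:
  assumes C: "assoc_algebra K C" and lam: "lam \<in> carrier K"
  shows "diff_algebra K lam C D \<longleftrightarrow> algebra_hom K C (dual_algebra lam C) (\<lambda>x. (x, D x))"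
proof
  assume "diff_algebra K lam C D"
  then interpret diff_algebra K lam C D .
  show "algebra_hom K C (dual_algebra lam C) (\<lambda>x. (x, D x))"
    by (rule algebra_homI) (simp_all add: dual_algebra_simps linear_mapD[OF d_linear] d_one d_mult)
next
  assume hom: "algebra_hom K C (dual_algebra lam C) (\<lambda>x. (x, D x))"
  interpret C: assoc_algebra K C by fact
  note h = algebra_homD[OF hom, unfolded dual_algebra_simps]
  have "diff_algebra_axioms K lam C D"
  proof (rule diff_algebra_axioms.intro[OF lam])
    show "linear_map K C C D"
      using h by (intro linear_mapI) auto
  qed (use h in auto)
  with C show "diff_algebra K lam C D"
    by (rule diff_algebra.intro)
qed

text \<open>Functoriality of C[\<epsilon>] in C, with \<phi> applied to each coefficient.\<close>

lemma dual_map_hom: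
  assumes "algebra_hom K B C \<phi>" and B: "assoc_algebra K B" and lam: "lam \<in> carrier K"
    and C: "assoc_algebra K C"
  shows "algebra_hom K (dual_algebra lam B) (dual_algebra lam C) (\<lambda>p. (\<phi> (fst p), \<phi> (snd p)))"
proof -
  interpret B: assoc_algebra K B by fact
  interpret C: assoc_algebra K C by fact
  note h = algebra_homD[OF assms(1)]
  have "\<phi> \<zero>\<^bsub>B\<^esub> = \<zero>\<^bsub>C\<^esub>"
    using linear_map_zero[OF B.module_axioms C.module_axioms algebra_hom_linear[OF assms(1)]] .
  then show ?thesis
    using lam by (intro algebra_homI) (auto simp: dual_algebra_simps h)
qed

text \<open>This is the substitution of 0 for \<epsilon>.\<close>

lemma dual_fst_hom: "algebra_hom K (dual_algebra lam C) C fst"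
  by (rule algebra_homI) (auto simp: dual_algebra_simps)

text \<open>Allows an operator to be replaced by its restriction to the carrier, which is
  extensional.\<close>

lemma diff_algebra_cong:
  assumes "diff_algebra K lam C D" "\<And>x. x \<in> carrier C \<Longrightarrow> D' x = D x"
  shows "diff_algebra K lam C D'"
proof -
  interpret diff_algebra K lam C D by fact
  note iff = diff_algebra_iff_dual_hom[OF assoc_algebra_axioms weight_closed]
  show ?thesis
    using assms(1) unfolding iff
    by (rule algebra_hom_cong[OF assoc_algebra_axioms]) (simp add: assms(2))
qed

text \<open>Put d' = d + \<lambda> id. Adding \<lambda>xy to both sides of the modified rule gives
  d(x)y + xd(y) + 2\<lambda>xy on the right, which is d'(x)y + xd'(y). The closure of the carrier
  under \<open>D\<close> is stated separately because it is not among the axioms for the shifted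
  operator.\<close>

lemma mdiff_algebra_iff_shift:
  assumes C: "assoc_algebra K C" and lam: "lam \<in> carrier K"
  shows "mdiff_algebra K lam C D \<longleftrightarrow>
    D \<in> carrier C \<rightarrow> carrier C \<and> diff_algebra K \<zero>\<^bsub>K\<^esub> C (\<lambda>x. D x \<oplus>\<^bsub>C\<^esub> lam \<odot>\<^bsub>C\<^esub> x)"
proof
  assume "mdiff_algebra K lam C D"
  then interpret mdiff_algebra K lam C D .
  note D = linear_mapD[OF d_linear]
  \<comment> \<open>The modified rule at 1 = 1 1 reads d(1) = 2d(1) + \<lambda>1, so d(1) =
    -\<lambda>1 and the shifted operator kills the unit.\<close>
  have D1: "D \<one>\<^bsub>C\<^esub> \<oplus>\<^bsub>C\<^esub> lam \<odot>\<^bsub>C\<^esub> \<one>\<^bsub>C\<^esub> = \<zero>\<^bsub>C\<^esub>"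
  proof -
    have "D \<one>\<^bsub>C\<^esub> = D \<one>\<^bsub>C\<^esub> \<oplus>\<^bsub>C\<^esub> (D \<one>\<^bsub>C\<^esub> \<oplus>\<^bsub>C\<^esub> lam \<odot>\<^bsub>C\<^esub> \<one>\<^bsub>C\<^esub>)"
      using d_mult[of "\<one>\<^bsub>C\<^esub>" "\<one>\<^bsub>C\<^esub>"] D(1) lam by (simp add: M.a_assoc)
    then show ?thesis
      using D(1)[of "\<one>\<^bsub>C\<^esub>"] lam by (metis M.add.l_cancel_one' M.a_closed A.one_closed smult_closed)
  qed
  have "diff_algebra_axioms K \<zero>\<^bsub>K\<^esub> C (\<lambda>x. D x \<oplus>\<^bsub>C\<^esub> lam \<odot>\<^bsub>C\<^esub> x)"
  proof (rule diff_algebra_axioms.intro)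
    show "linear_map K C C (\<lambda>x. D x \<oplus>\<^bsub>C\<^esub> lam \<odot>\<^bsub>C\<^esub> x)"
      using lam by (intro linear_mapI) (simp_all add: D smult_r_distr smult_left_commute M.a_ac)
  qed (use lam D in \<open>simp_all add: D1 d_mult A.l_distr A.r_distr smult_mult_left smult_mult_right M.a_ac\<close>)
  then show "D \<in> carrier C \<rightarrow> carrier C \<and> diff_algebra K \<zero>\<^bsub>K\<^esub> C (\<lambda>x. D x \<oplus>\<^bsub>C\<^esub> lam \<odot>\<^bsub>C\<^esub> x)"
    using D(1) C by (auto intro: diff_algebra.intro)
next
  assume asm: "D \<in> carrier C \<rightarrow> carrier C \<and> diff_algebra K \<zero>\<^bsub>K\<^esub> C (\<lambda>x. D x \<oplus>\<^bsub>C\<^esub> lam \<odot>\<^bsub>C\<^esub> x)"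
  then interpret diff_algebra K "\<zero>\<^bsub>K\<^esub>" C "\<lambda>x. D x \<oplus>\<^bsub>C\<^esub> lam \<odot>\<^bsub>C\<^esub> x"
    by blast
  have D: "D x \<in> carrier C" if "x \<in> carrier C" for x
    using asm that by auto
  note h = linear_mapD[OF d_linear]
  \<comment> \<open>Each law for \<open>D\<close> follows from the law for the shifted operator by
    adding the same \<lambda> term to both sides and cancelling it.\<close>
  have cancel: "x = y" if "x \<oplus>\<^bsub>C\<^esub> z = y \<oplus>\<^bsub>C\<^esub> z" "x \<in> carrier C" "y \<in> carrier C" "z \<in> carrier C" for x y z
    using that by simp
  have "mdiff_algebra_axioms K lam C D"
  proof (rule mdiff_algebra_axioms.intro[OF lam])
    show "linear_map K C C D"
    proof (rule linear_mapI)
      fix x y assume xy: "x \<in> carrier C" "y \<in> carrier C"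
      show "D (x \<oplus>\<^bsub>C\<^esub> y) = D x \<oplus>\<^bsub>C\<^esub> D y"
        by (rule cancel[of _ "lam \<odot>\<^bsub>C\<^esub> (x \<oplus>\<^bsub>C\<^esub> y)"])
          (use xy lam h(2)[OF xy] in \<open>simp_all add: D smult_r_distr M.a_ac\<close>)
    next
      fix c x assume cx: "c \<in> carrier K" "x \<in> carrier C"
      show "D (c \<odot>\<^bsub>C\<^esub> x) = c \<odot>\<^bsub>C\<^esub> D x"
        by (rule cancel[of _ "lam \<odot>\<^bsub>C\<^esub> (c \<odot>\<^bsub>C\<^esub> x)"])
          (use cx lam h(3)[OF cx] in \<open>simp_all add: D smult_r_distr smult_left_commute\<close>)
    qed (rule D)
  next
    fix x y assume xy: "x \<in> carrier C" "y \<in> carrier C"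
    show "D (x \<otimes>\<^bsub>C\<^esub> y) = D x \<otimes>\<^bsub>C\<^esub> y \<oplus>\<^bsub>C\<^esub> x \<otimes>\<^bsub>C\<^esub> D y \<oplus>\<^bsub>C\<^esub> lam \<odot>\<^bsub>C\<^esub> (x \<otimes>\<^bsub>C\<^esub> y)"
      by (rule cancel[of _ "lam \<odot>\<^bsub>C\<^esub> (x \<otimes>\<^bsub>C\<^esub> y)"])
        (use xy lam d_mult[OF xy] in \<open>simp_all add: D A.l_distr A.r_distr smult_mult_left
          smult_mult_right M.a_ac\<close>)
  qed
  with C show "mdiff_algebra K lam C D"
    by (rule mdiff_algebra.intro)
qed

text \<open>The computation for the product carries over to the bracket because that is bilinear
  too.\<close>

lemma mDL_algebra_shift:
  assumes "mDL_algebra K lam L br d"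
  shows "DL_algebra K \<zero>\<^bsub>K\<^esub> L br (\<lambda>x. d x \<oplus>\<^bsub>L\<^esub> lam \<odot>\<^bsub>L\<^esub> x)"
proof -
  interpret mDL_algebra K lam L br d by fact
  note d = linear_mapD[OF d_linear] and lam = weight_closed
  note left = linear_mapD[OF br_linear_left] and right = linear_mapD[OF br_linear_right]
  show ?thesis
  proof (rule DL_algebra.intro[OF lie_algebra_axioms], rule DL_algebra_axioms.intro)
    show "linear_map K L L (\<lambda>x. d x \<oplus>\<^bsub>L\<^esub> lam \<odot>\<^bsub>L\<^esub> x)"
      using lam by (intro linear_mapI) (simp_all add: d smult_r_distr smult_left_commute M.a_ac)
  qed (use lam in \<open>simp_all add: d d_br left right smult_r_distr M.a_ac\<close>)
qed

section \<open>The differential on the enveloping algebra\<close>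

text \<open>Adds three relations, the third scaled by \<open>c\<close>. The terms \<open>v\<close>
  and \<open>u\<close> occur in swapped order because the product with \<open>b\<close> on the left
  of \<open>a\<close> differentiates \<open>b\<close> first, while the bracket of \<open>a\<close>
  and \<open>b\<close> differentiates \<open>a\<close> first.\<close>

lemma (in module) twisted_sum_regroup:
  assumes "p \<oplus>\<^bsub>M\<^esub> u = p'" "q \<oplus>\<^bsub>M\<^esub> v = q'" "r \<oplus>\<^bsub>M\<^esub> w = r'" "c \<in> carrier R"
    and "p \<in> carrier M" "u \<in> carrier M" "q \<in> carrier M" "v \<in> carrier M" "r \<in> carrier M" "w \<in> carrier M"
  shows "p \<oplus>\<^bsub>M\<^esub> q \<oplus>\<^bsub>M\<^esub> c \<odot>\<^bsub>M\<^esub> r \<oplus>\<^bsub>M\<^esub> (v \<oplus>\<^bsub>M\<^esub> u \<oplus>\<^bsub>M\<^esub> c \<odot>\<^bsub>M\<^esub> w)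
    = p' \<oplus>\<^bsub>M\<^esub> q' \<oplus>\<^bsub>M\<^esub> c \<odot>\<^bsub>M\<^esub> r'"
  using assms(4-) by (simp add: assms(1-3)[symmetric] smult_r_distr M.a_ac)

context
  fixes K (structure) and A (structure) and lam and br and d
  assumes diff: "diff_algebra K lam A d" and lie: "DL_algebra K lam A br d"
begin

interpretation A: diff_algebra K lam A d
  by (rule diff)

interpretation L: DL_algebra K lam A br d
  by (rule lie)

lemma br_Pi: "br \<in> carrier A \<rightarrow> carrier A \<rightarrow> carrier A"
  using linear_mapD(1)[OF L.br_linear_right] by blast

lemmas ue_props = ue_assoc_algebra[OF A.assoc_algebra_axioms br_Pi]
  ue_pair_ue[OF A.assoc_algebra_axioms br_Pi]

interpretation U: assoc_algebra K "ue K A br"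
  by (rule ue_props(1))

text \<open>By the rule for \<open>d\<close>, the \<epsilon> part of each quadratic relation at (a,
  b) is the sum of the same relation at (d a, b), at (a, d b) and \<lambda> times that at (d a, d
  b). All three hold in the enveloping algebra.\<close>

lemma ue_pair_dual:
  "ue_pair K A br (dual_algebra lam (ue K A br))
    (\<lambda>a. (ue_M K A br a, ue_M K A br (d a))) (\<lambda>a. (ue_H K A br a, ue_H K A br (d a)))"
proof -
  let ?M = "ue_M K A br" and ?H = "ue_H K A br"
  note rel = ue_pairD(3-)[OF ue_props(2)]
  note M_lin = ue_pairD(1)[OF ue_props(2)] and H_lin = ue_pairD(2)[OF ue_props(2)]
  note M = linear_mapD[OF M_lin] and H = linear_mapD[OF H_lin]
  note d = linear_mapD[OF A.d_linear] and lam = A.weight_closed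
  have M_zero: "?M \<zero>\<^bsub>A\<^esub> = \<zero>\<^bsub>ue K A br\<^esub>"
    by (rule linear_map_zero[OF A.module_axioms U.module_axioms M_lin])
  show ?thesis
    unfolding ue_pair_def
  proof (intro conjI ballI)
    show "linear_map K A (dual_algebra lam (ue K A br)) (\<lambda>a. (?M a, ?M (d a)))"
      by (rule linear_mapI) (simp_all add: dual_algebra_simps M d)
    show "linear_map K A (dual_algebra lam (ue K A br)) (\<lambda>a. (?H a, ?H (d a)))"
      by (rule linear_mapI) (simp_all add: dual_algebra_simps H d)
    show "(?M \<one>\<^bsub>A\<^esub>, ?M (d \<one>\<^bsub>A\<^esub>)) = \<one>\<^bsub>dual_algebra lam (ue K A br)\<^esub>"
      by (simp add: dual_algebra_simps rel(1) A.d_one M_zero)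
  next
    fix a b assume ab: "a \<in> carrier A" "b \<in> carrier A"
    note c = ab lam d(1)[OF ab(1)] d(1)[OF ab(2)] linear_mapD(1)[OF L.br_linear_right] M(1) H(1)
    show "(?M (a \<otimes>\<^bsub>A\<^esub> b), ?M (d (a \<otimes>\<^bsub>A\<^esub> b)))
        = (?M a, ?M (d a)) \<otimes>\<^bsub>dual_algebra lam (ue K A br)\<^esub> (?M b, ?M (d b))"
      by (simp add: dual_algebra_simps c A.d_mult M(2,3) rel(2))
    show "(?H (br a b), ?H (d (br a b))) \<oplus>\<^bsub>dual_algebra lam (ue K A br)\<^esub>
          (?H b, ?H (d b)) \<otimes>\<^bsub>dual_algebra lam (ue K A br)\<^esub> (?H a, ?H (d a))
        = (?H a, ?H (d a)) \<otimes>\<^bsub>dual_algebra lam (ue K A br)\<^esub> (?H b, ?H (d b))"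
    proof -
      have "?H (br (d a) b) \<oplus>\<^bsub>ue K A br\<^esub> ?H (br a (d b)) \<oplus>\<^bsub>ue K A br\<^esub> lam \<odot>\<^bsub>ue K A br\<^esub> ?H (br (d a) (d b))
          \<oplus>\<^bsub>ue K A br\<^esub> (?H (d b) \<otimes>\<^bsub>ue K A br\<^esub> ?H a \<oplus>\<^bsub>ue K A br\<^esub> ?H b \<otimes>\<^bsub>ue K A br\<^esub> ?H (d a)
            \<oplus>\<^bsub>ue K A br\<^esub> lam \<odot>\<^bsub>ue K A br\<^esub> (?H (d b) \<otimes>\<^bsub>ue K A br\<^esub> ?H (d a)))
          = ?H (d a) \<otimes>\<^bsub>ue K A br\<^esub> ?H b \<oplus>\<^bsub>ue K A br\<^esub> ?H a \<otimes>\<^bsub>ue K A br\<^esub> ?H (d b)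
            \<oplus>\<^bsub>ue K A br\<^esub> lam \<odot>\<^bsub>ue K A br\<^esub> (?H (d a) \<otimes>\<^bsub>ue K A br\<^esub> ?H (d b))"
        by (rule U.twisted_sum_regroup) (simp_all add: c rel(3))
      then show ?thesis
        by (simp add: dual_algebra_simps c L.d_br H(2,3) rel(3))
    qed
    show "(?M (br a b), ?M (d (br a b))) \<oplus>\<^bsub>dual_algebra lam (ue K A br)\<^esub>
          (?M b, ?M (d b)) \<otimes>\<^bsub>dual_algebra lam (ue K A br)\<^esub> (?H a, ?H (d a))
        = (?H a, ?H (d a)) \<otimes>\<^bsub>dual_algebra lam (ue K A br)\<^esub> (?M b, ?M (d b))"
    proof -
      have "?M (br (d a) b) \<oplus>\<^bsub>ue K A br\<^esub> ?M (br a (d b)) \<oplus>\<^bsub>ue K A br\<^esub> lam \<odot>\<^bsub>ue K A br\<^esub> ?M (br (d a) (d b))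
          \<oplus>\<^bsub>ue K A br\<^esub> (?M (d b) \<otimes>\<^bsub>ue K A br\<^esub> ?H a \<oplus>\<^bsub>ue K A br\<^esub> ?M b \<otimes>\<^bsub>ue K A br\<^esub> ?H (d a)
            \<oplus>\<^bsub>ue K A br\<^esub> lam \<odot>\<^bsub>ue K A br\<^esub> (?M (d b) \<otimes>\<^bsub>ue K A br\<^esub> ?H (d a)))
          = ?H (d a) \<otimes>\<^bsub>ue K A br\<^esub> ?M b \<oplus>\<^bsub>ue K A br\<^esub> ?H a \<otimes>\<^bsub>ue K A br\<^esub> ?M (d b)
            \<oplus>\<^bsub>ue K A br\<^esub> lam \<odot>\<^bsub>ue K A br\<^esub> (?H (d a) \<otimes>\<^bsub>ue K A br\<^esub> ?M (d b))"
        by (rule U.twisted_sum_regroup) (simp_all add: c rel(4))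
      then show ?thesis
        by (simp add: dual_algebra_simps c L.d_br M(2,3) rel(4))
    qed
    show "(?H (a \<otimes>\<^bsub>A\<^esub> b), ?H (d (a \<otimes>\<^bsub>A\<^esub> b)))
        = (?M a, ?M (d a)) \<otimes>\<^bsub>dual_algebra lam (ue K A br)\<^esub> (?H b, ?H (d b))
          \<oplus>\<^bsub>dual_algebra lam (ue K A br)\<^esub>
          (?M b, ?M (d b)) \<otimes>\<^bsub>dual_algebra lam (ue K A br)\<^esub> (?H a, ?H (d a))"
      by (simp add: dual_algebra_simps c A.d_mult H(2,3) rel(5) U.smult_r_distr U.M.a_ac)
  qed
qed

text \<open>The lift to dual numbers has the form x + \<epsilon> D(x), and \<open>D\<close> is read
  off as its second component.\<close>

lemma ue_diff_exists:
  "\<exists>D. diff_algebra K lam (ue K A br) D \<and>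
    (\<forall>a\<in>carrier A. D (ue_M K A br a) = ue_M K A br (d a) \<and> D (ue_H K A br a) = ue_H K A br (d a))"
proof -
  let ?U = "ue K A br"
  obtain \<phi> where \<phi>: "algebra_hom K ?U (dual_algebra lam ?U) \<phi>"
    and gen: "\<And>a. a \<in> carrier A \<Longrightarrow> \<phi> (ue_M K A br a) = (ue_M K A br a, ue_M K A br (d a))"
      "\<And>a. a \<in> carrier A \<Longrightarrow> \<phi> (ue_H K A br a) = (ue_H K A br a, ue_H K A br (d a))"
    using ue_lift[OF A.assoc_algebra_axioms br_Pi U.dual_assoc_algebra[OF A.weight_closed]
        ue_pair_dual] by blast
  have id: "algebra_hom K ?U ?U (\<lambda>x. x)"
    by (rule algebra_homI) simp_all
  \<comment> \<open>Setting \<epsilon> to 0 after \<phi> gives an endomorphism that fixes the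
    generators, hence the identity.\<close>
  have fst: "fst (\<phi> x) = x" if "x \<in> carrier ?U" for x
    by (rule ue_hom_unique[OF A.assoc_algebra_axioms br_Pi U.assoc_algebra_axioms
          algebra_hom_compose[OF \<phi> dual_fst_hom] id _ _ that]) (simp_all add: gen)
  have "algebra_hom K ?U (dual_algebra lam ?U) (\<lambda>x. (x, snd (\<phi> x)))"
    by (rule algebra_hom_cong[OF U.assoc_algebra_axioms \<phi>]) (metis fst prod.collapse)
  then have "diff_algebra K lam ?U (\<lambda>x. snd (\<phi> x))"
    by (simp only: diff_algebra_iff_dual_hom[OF U.assoc_algebra_axioms A.weight_closed])
  then show ?thesis
    using gen by (intro exI[of _ "\<lambda>x. snd (\<phi> x)"]) simp
qed

lemma ue_diff_unique:
  assumes D: "diff_algebra K lam (ue K A br) D" and D': "diff_algebra K lam (ue K A br) D'"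
    and gen: "\<And>a. a \<in> carrier A \<Longrightarrow> D (ue_M K A br a) = D' (ue_M K A br a)"
      "\<And>a. a \<in> carrier A \<Longrightarrow> D (ue_H K A br a) = D' (ue_H K A br a)"
    and x: "x \<in> carrier (ue K A br)"
  shows "D x = D' x"
proof -
  note iff = diff_algebra_iff_dual_hom[OF U.assoc_algebra_axioms A.weight_closed]
  have "(x, D x) = (x, D' x)"
    by (rule ue_hom_unique[OF A.assoc_algebra_axioms br_Pi
          U.dual_assoc_algebra[OF A.weight_closed] D[unfolded iff] D'[unfolded iff] _ _ x])
      (simp_all add: gen)
  then show ?thesis by simp
qed

text \<open>Two routes lead to B[\<epsilon>]: first x + \<epsilon> D(x) and then \<phi> on
  coefficients, or first \<phi> and then y + \<epsilon> dB(y). Both are homomorphisms and they agree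
  on generators; their \<epsilon> parts are the two sides.\<close>

lemma ue_hom_commutes_diff:
  assumes D: "diff_algebra K lam (ue K A br) D" and dB: "diff_algebra K lam B dB"
    and \<phi>: "algebra_hom K (ue K A br) B \<phi>"
    and gen: "\<And>a. a \<in> carrier A \<Longrightarrow> \<phi> (D (ue_M K A br a)) = dB (\<phi> (ue_M K A br a))"
      "\<And>a. a \<in> carrier A \<Longrightarrow> \<phi> (D (ue_H K A br a)) = dB (\<phi> (ue_H K A br a))"
    and x: "x \<in> carrier (ue K A br)"
  shows "\<phi> (D x) = dB (\<phi> x)"
proof -
  interpret B: diff_algebra K lam B dB by fact
  note lam = A.weight_closed
  note D_hom = D[unfolded diff_algebra_iff_dual_hom[OF U.assoc_algebra_axioms lam]]
    and dB_hom = dB[unfolded diff_algebra_iff_dual_hom[OF B.assoc_algebra_axioms lam]]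
  note \<phi>D = algebra_hom_compose[OF D_hom
      dual_map_hom[OF \<phi> U.assoc_algebra_axioms lam B.assoc_algebra_axioms], simplified]
  have "(\<phi> x, \<phi> (D x)) = (\<phi> x, dB (\<phi> x))"
    by (rule ue_hom_unique[OF A.assoc_algebra_axioms br_Pi B.dual_assoc_algebra[OF lam]
          \<phi>D algebra_hom_compose[OF \<phi> dB_hom] _ _ x]) (simp_all add: gen)
  then show ?thesis by simp
qed

end

text \<open>Operators that agree on generators agree on the carrier only. Among extensional ones
  this is equality of functions, so the definite description denotes the restriction of any operator
  from \<open>ue_diff_exists\<close>.\<close>

lemma ue_diff_props:
  assumes A: "diff_algebra K lam A d" "DL_algebra K lam A br d"
  shows "diff_algebra K lam (ue K A br) (ue_diff K lam A br d)"
    and "a \<in> carrier A \<Longrightarrow> ue_diff K lam A br d (ue_M K A br a) = ue_M K A br (d a)"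
    and "a \<in> carrier A \<Longrightarrow> ue_diff K lam A br d (ue_H K A br a) = ue_H K A br (d a)"
proof -
  let ?U = "ue K A br"
  let ?P = "\<lambda>D. D \<in> extensional (carrier ?U) \<and> diff_algebra K lam ?U D \<and>
    (\<forall>a\<in>carrier A. D (ue_M K A br a) = ue_M K A br (d a) \<and> D (ue_H K A br a) = ue_H K A br (d a))"
  obtain D where D: "diff_algebra K lam ?U D"
    "\<And>a. a \<in> carrier A \<Longrightarrow> D (ue_M K A br a) = ue_M K A br (d a)"
    "\<And>a. a \<in> carrier A \<Longrightarrow> D (ue_H K A br a) = ue_H K A br (d a)"
    using ue_diff_exists[OF A] by blast
  note closed = linear_mapD(1)[OF ue_pairD(1)[OF ue_props(2)[OF A]]]
    linear_mapD(1)[OF ue_pairD(2)[OF ue_props(2)[OF A]]]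
  have "?P (restrict D (carrier ?U))"
    using D closed diff_algebra_cong[OF D(1), of "restrict D (carrier ?U)"] by auto
  moreover have "D1 = D2" if P: "?P D1" "?P D2" for D1 D2
  proof (rule extensionalityI)
    have D: "diff_algebra K lam ?U D1" "diff_algebra K lam ?U D2"
      using P by auto
    show "D1 x = D2 x" if "x \<in> carrier ?U" for x
      by (rule ue_diff_unique[OF A D _ _ that]) (use P in simp_all)
  qed (use P in auto)
  ultimately have "\<exists>!D. ?P D"
    by blast
  from theI'[OF this]
  show "diff_algebra K lam ?U (ue_diff K lam A br d)"
    and "a \<in> carrier A \<Longrightarrow> ue_diff K lam A br d (ue_M K A br a) = ue_M K A br (d a)"
    and "a \<in> carrier A \<Longrightarrow> ue_diff K lam A br d (ue_H K A br a) = ue_H K A br (d a)"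
    by (simp_all add: ue_diff_def)
qed

section \<open>The modified differential on the enveloping algebra\<close>

lemma mdiff_algebra_shift:
  assumes "mdiff_algebra K lam A d"
  shows "diff_algebra K \<zero>\<^bsub>K\<^esub> A (\<lambda>x. d x \<oplus>\<^bsub>A\<^esub> lam \<odot>\<^bsub>A\<^esub> x)"
  using mdiff_algebra_iff_shift[OF mdiff_algebra.axioms(1)[OF assms]
      mdiff_algebra.weight_closed[OF assms]] assms by blast

lemma ue_mdiff_props:
  assumes A: "mdiff_algebra K lam A d" "mDL_algebra K lam A br d"
  shows "mdiff_algebra K lam (ue K A br) (ue_mdiff K lam A br d)"
    and "a \<in> carrier A \<Longrightarrow> ue_mdiff K lam A br d (ue_M K A br a) = ue_M K A br (d a)"
    and "a \<in> carrier A \<Longrightarrow> ue_mdiff K lam A br d (ue_H K A br a) = ue_H K A br (d a)"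
proof -
  interpret A: mdiff_algebra K lam A d by fact
  let ?U = "ue K A br" and ?d' = "\<lambda>x. d x \<oplus>\<^bsub>A\<^esub> lam \<odot>\<^bsub>A\<^esub> x"
  let ?P = "\<lambda>D. D \<in> extensional (carrier ?U) \<and> mdiff_algebra K lam ?U D \<and>
    (\<forall>a\<in>carrier A. D (ue_M K A br a) = ue_M K A br (d a) \<and> D (ue_H K A br a) = ue_H K A br (d a))"
  \<comment> \<open>The shifted structure has weight 0 and the same product and bracket, hence the
    same enveloping algebra.\<close>
  note A0 = mdiff_algebra_shift[OF A(1)] mDL_algebra_shift[OF A(2)]
  note pair = ue_props(2)[OF A0]
  interpret U: assoc_algebra K ?U
    by (rule ue_props(1)[OF A0])
  note M = linear_mapD[OF ue_pairD(1)[OF pair]] and H = linear_mapD[OF ue_pairD(2)[OF pair]]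
  note lam = A.weight_closed and d = linear_mapD[OF A.d_linear]
  obtain D where D: "diff_algebra K \<zero>\<^bsub>K\<^esub> ?U D"
    "\<And>a. a \<in> carrier A \<Longrightarrow> D (ue_M K A br a) = ue_M K A br (?d' a)"
    "\<And>a. a \<in> carrier A \<Longrightarrow> D (ue_H K A br a) = ue_H K A br (?d' a)"
    using ue_diff_exists[OF A0] by blast
  note D_closed = linear_mapD(1)[OF diff_algebra.d_linear[OF D(1)]]
  \<comment> \<open>Undoes the shift: \<open>D\<close> sends the generator of \<open>a\<close> to
    that of \<open>d a\<close> plus \<lambda> times that of \<open>a\<close>, so subtracting
    \<lambda> id leaves the generator of \<open>d a\<close>.\<close>
  define E where "E = restrict (\<lambda>x. D x \<ominus>\<^bsub>?U\<^esub> lam \<odot>\<^bsub>?U\<^esub> x) (carrier ?U)"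
  have "diff_algebra K \<zero>\<^bsub>K\<^esub> ?U (\<lambda>x. E x \<oplus>\<^bsub>?U\<^esub> lam \<odot>\<^bsub>?U\<^esub> x)"
    using lam D_closed
    by (intro diff_algebra_cong[OF D(1)])
      (simp add: E_def U.minus_eq U.M.a_assoc U.M.l_neg)
  then have "mdiff_algebra K lam ?U E"
    using lam D_closed by (subst mdiff_algebra_iff_shift[OF U.assoc_algebra_axioms lam]) (auto simp: E_def)
  moreover have "E (ue_M K A br a) = ue_M K A br (d a)" "E (ue_H K A br a) = ue_H K A br (d a)"
    if a: "a \<in> carrier A" for a
    using a lam by (simp_all add: E_def D(2,3) M H d U.minus_eq U.M.a_assoc U.M.r_neg)
  ultimately have "?P E"
    by (simp add: E_def)
  moreover have "D1 = D2" if P: "?P D1" "?P D2" for D1 D2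
  proof (rule extensionalityI)
    fix x assume x: "x \<in> carrier ?U"
    have m: "mdiff_algebra K lam ?U D1" "mdiff_algebra K lam ?U D2"
      using P by auto
    \<comment> \<open>Uniqueness is available in weight 0, so the shifts of both operators are
      compared and \<lambda>x is cancelled afterwards.\<close>
    have "D1 x \<oplus>\<^bsub>?U\<^esub> lam \<odot>\<^bsub>?U\<^esub> x = D2 x \<oplus>\<^bsub>?U\<^esub> lam \<odot>\<^bsub>?U\<^esub> x"
      using P by (intro ue_diff_unique[OF A0 mdiff_algebra_shift[OF m(1)] mdiff_algebra_shift[OF m(2)] _ _ x])
        auto
    then show "D1 x = D2 x"
      using x lam linear_mapD(1)[OF mdiff_algebra.d_linear[OF m(1)]]
        linear_mapD(1)[OF mdiff_algebra.d_linear[OF m(2)]] by simp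
  qed (use P in auto)
  ultimately have "\<exists>!D. ?P D"
    by blast
  from theI'[OF this]
  show "mdiff_algebra K lam ?U (ue_mdiff K lam A br d)"
    and "a \<in> carrier A \<Longrightarrow> ue_mdiff K lam A br d (ue_M K A br a) = ue_M K A br (d a)"
    and "a \<in> carrier A \<Longrightarrow> ue_mdiff K lam A br d (ue_H K A br a) = ue_H K A br (d a)"
    by (simp_all add: ue_mdiff_def)
qed

section \<open>The universal homomorphism to the target of a triple\<close>

lemma ue_hom_ex1:
  assumes A: "assoc_algebra K A" and br: "br \<in> carrier A \<rightarrow> carrier A \<rightarrow> carrier A"
    and C: "assoc_algebra K C" and fg: "ue_pair K A br C f g"
  shows "\<exists>!\<phi>. \<phi> \<in> extensional (carrier (ue K A br)) \<and> algebra_hom K (ue K A br) C \<phi> \<and>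
    (\<forall>a\<in>carrier A. \<phi> (ue_M K A br a) = f a \<and> \<phi> (ue_H K A br a) = g a)"
proof -
  let ?U = "ue K A br"
  let ?P = "\<lambda>\<phi>. \<phi> \<in> extensional (carrier ?U) \<and> algebra_hom K ?U C \<phi> \<and>
    (\<forall>a\<in>carrier A. \<phi> (ue_M K A br a) = f a \<and> \<phi> (ue_H K A br a) = g a)"
  obtain \<phi> where \<phi>: "algebra_hom K ?U C \<phi>"
    "\<And>a. a \<in> carrier A \<Longrightarrow> \<phi> (ue_M K A br a) = f a" "\<And>a. a \<in> carrier A \<Longrightarrow> \<phi> (ue_H K A br a) = g a"
    using ue_lift[OF A br C fg] by blast
  note closed = linear_mapD(1)[OF ue_M_linear[OF A br]] linear_mapD(1)[OF ue_H_linear[OF A br]]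
  have "?P (restrict \<phi> (carrier ?U))"
    using \<phi> closed algebra_hom_cong[OF ue_assoc_algebra[OF A br] \<phi>(1), of "restrict \<phi> (carrier ?U)"]
    by auto
  moreover have "\<phi>1 = \<phi>2" if P: "?P \<phi>1" "?P \<phi>2" for \<phi>1 \<phi>2
  proof (rule extensionalityI)
    have \<phi>: "algebra_hom K ?U C \<phi>1" "algebra_hom K ?U C \<phi>2"
      using P by auto
    show "\<phi>1 x = \<phi>2 x" if "x \<in> carrier ?U" for x
      by (rule ue_hom_unique[OF A br C \<phi> _ _ that]) (use P in simp_all)
  qed (use P in auto)
  ultimately show ?thesis
    by blast
qed

text \<open>Collects what makes a triple a \<open>ue_pair\<close>. No operator occurs in it, so it
  serves ordinary and modified triples alike.\<close>

lemma ue_pairI_commutator: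
  assumes "assoc_algebra K C" and f: "algebra_hom K A C f" and g: "linear_map K A C g"
    and br: "br \<in> carrier A \<rightarrow> carrier A \<rightarrow> carrier A"
    and g_br: "\<And>a b. a \<in> carrier A \<Longrightarrow> b \<in> carrier A \<Longrightarrow> g (br a b) = commutator C (g a) (g b)"
    and f_br: "\<And>a b. a \<in> carrier A \<Longrightarrow> b \<in> carrier A \<Longrightarrow>
      f (br a b) = g a \<otimes>\<^bsub>C\<^esub> f b \<ominus>\<^bsub>C\<^esub> f b \<otimes>\<^bsub>C\<^esub> g a"
    and g_mult: "\<And>a b. a \<in> carrier A \<Longrightarrow> b \<in> carrier A \<Longrightarrow>
      g (a \<otimes>\<^bsub>A\<^esub> b) = f a \<otimes>\<^bsub>C\<^esub> g b \<oplus>\<^bsub>C\<^esub> f b \<otimes>\<^bsub>C\<^esub> g a"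
  shows "ue_pair K A br C f g"
proof -
  interpret C: assoc_algebra K C by fact
  note f' = algebra_homD[OF f] and g' = linear_mapD[OF g]
  have "g (br a b) \<oplus>\<^bsub>C\<^esub> g b \<otimes>\<^bsub>C\<^esub> g a = g a \<otimes>\<^bsub>C\<^esub> g b"
    "f (br a b) \<oplus>\<^bsub>C\<^esub> f b \<otimes>\<^bsub>C\<^esub> g a = g a \<otimes>\<^bsub>C\<^esub> f b"
    if ab: "a \<in> carrier A" "b \<in> carrier A" for a b
    using g_br[OF ab] f_br[OF ab] f'(1) g'(1) ab funcset_mem[OF funcset_mem[OF br ab(1)] ab(2)]
    by (simp_all add: commutator_def C.eq_minus_iff)
  then show ?thesis
    using f g f'(3,5) g_mult by (simp add: ue_pair_def algebra_hom_linear)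
qed

text \<open>A homomorphism is determined on the carrier only, so uniqueness is stated among
  extensional maps.\<close>

theorem theorem3p5:
  fixes K :: "('k, 'c) ring_scheme" and lam :: 'k
    and A :: "('k, 'a, 'm) module_scheme" and brA :: "'a \<Rightarrow> 'a \<Rightarrow> 'a" and dA :: "'a \<Rightarrow> 'a"
    and B :: "('k, 'b, 'n) module_scheme" and dB :: "'b \<Rightarrow> 'b"
    and f g :: "'a \<Rightarrow> 'b"
  assumes "field K" and "char_zero K" and "lam \<in> carrier K"
  shows
    "(DP_algebra K lam A brA dA \<and> P_triple K lam A brA dA B dB f g \<longrightarrow>
        (\<exists>!\<phi>. \<phi> \<in> extensional (carrier (ue K A brA)) \<and>
          diff_algebra_hom K lam (ue K A brA) (ue_diff K lam A brA dA) B dB \<phi> \<and>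
          (\<forall>a\<in>carrier A. \<phi> (ue_M K A brA a) = f a \<and> \<phi> (ue_H K A brA a) = g a))) \<and>
     (mDP_algebra K lam A brA dA \<and> mP_triple K lam A brA dA B dB f g \<longrightarrow>
        (\<exists>!\<phi>. \<phi> \<in> extensional (carrier (ue K A brA)) \<and>
          mdiff_algebra_hom K lam (ue K A brA) (ue_mdiff K lam A brA dA) B dB \<phi> \<and>
          (\<forall>a\<in>carrier A. \<phi> (ue_M K A brA a) = f a \<and> \<phi> (ue_H K A brA a) = g a)))"
proof (intro conjI impI)
  assume asm: "DP_algebra K lam A brA dA \<and> P_triple K lam A brA dA B dB f g"
  then interpret A: DP_algebra K lam A brA dA by blast
  from asm interpret P: P_triple K lam A brA dA B dB f g by blast
  note A = A.diff_algebra_axioms A.lie.DL_algebra_axioms and B = P.f.cod.diff_algebra_axioms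
  note D = ue_diff_props[OF A]
  have fg: "ue_pair K A brA B f g"
    by (rule ue_pairI_commutator[OF P.f.cod.assoc_algebra_axioms P.f.hom P.g.linear])
      (simp_all add: br_Pi[OF A, simplified] P.g.hom_br P.P3 P.P4)
  \<comment> \<open>Because \<open>f\<close> and \<open>g\<close> commute with the operators, an
    algebra homomorphism with these values commutes with them on generators and so everywhere. The
    condition on operators is then automatic, and the claim becomes
    \<open>ue_hom_ex1\<close>.\<close>
  have iff: "diff_algebra_hom K lam (ue K A brA) (ue_diff K lam A brA dA) B dB \<phi> \<longleftrightarrow>
      algebra_hom K (ue K A brA) B \<phi>"
    if "\<forall>a\<in>carrier A. \<phi> (ue_M K A brA a) = f a \<and> \<phi> (ue_H K A brA a) = g a" for \<phi>
  proof
    assume \<phi>: "algebra_hom K (ue K A brA) B \<phi>"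
    have "\<phi> (ue_diff K lam A brA dA x) = dB (\<phi> x)" if "x \<in> carrier (ue K A brA)" for x
      by (rule ue_hom_commutes_diff[OF A D(1) B \<phi> _ _ that])
        (use \<open>\<forall>a\<in>_. _\<close> in \<open>simp_all add: D(2,3) linear_mapD(1)[OF A.d_linear] P.f.comm_d P.g.comm_d\<close>)
    with \<phi> show "diff_algebra_hom K lam (ue K A brA) (ue_diff K lam A brA dA) B dB \<phi>"
      using D(1) B by (intro diff_algebra_hom.intro diff_algebra_hom_axioms.intro)
  qed (rule diff_algebra_hom.hom)
  show "\<exists>!\<phi>. \<phi> \<in> extensional (carrier (ue K A brA)) \<and>
      diff_algebra_hom K lam (ue K A brA) (ue_diff K lam A brA dA) B dB \<phi> \<and>
      (\<forall>a\<in>carrier A. \<phi> (ue_M K A brA a) = f a \<and> \<phi> (ue_H K A brA a) = g a)"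
  proof -
    have "\<phi> \<in> extensional (carrier (ue K A brA)) \<and>
        diff_algebra_hom K lam (ue K A brA) (ue_diff K lam A brA dA) B dB \<phi> \<and>
        (\<forall>a\<in>carrier A. \<phi> (ue_M K A brA a) = f a \<and> \<phi> (ue_H K A brA a) = g a) \<longleftrightarrow>
      \<phi> \<in> extensional (carrier (ue K A brA)) \<and> algebra_hom K (ue K A brA) B \<phi> \<and>
        (\<forall>a\<in>carrier A. \<phi> (ue_M K A brA a) = f a \<and> \<phi> (ue_H K A brA a) = g a)" for \<phi>
      using iff by blast
    then show ?thesis
      by (simp only: ue_hom_ex1[OF A.assoc_algebra_axioms br_Pi[OF A] P.f.cod.assoc_algebra_axioms fg])
  qed
next
  assume asm: "mDP_algebra K lam A brA dA \<and> mP_triple K lam A brA dA B dB f g"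
  then interpret A: mDP_algebra K lam A brA dA by blast
  from asm interpret P: mP_triple K lam A brA dA B dB f g by blast
  note A = A.mdiff_algebra_axioms A.lie.mDL_algebra_axioms and B = P.f.cod.mdiff_algebra_axioms
  note A0 = mdiff_algebra_shift[OF A(1)] mDL_algebra_shift[OF A(2)]
  note D = ue_mdiff_props[OF A]
  interpret U: mdiff_algebra K lam "ue K A brA" "ue_mdiff K lam A brA dA"
    by (rule D(1))
  have fg: "ue_pair K A brA B f g"
    by (rule ue_pairI_commutator[OF P.f.cod.assoc_algebra_axioms P.f.hom P.g.linear])
      (simp_all add: br_Pi[OF A0, simplified] P.g.hom_br P.P3 P.P4)
  note M_closed = linear_mapD(1)[OF ue_M_linear[OF A.assoc_algebra_axioms br_Pi[OF A0]]]
    and H_closed = linear_mapD(1)[OF ue_H_linear[OF A.assoc_algebra_axioms br_Pi[OF A0]]]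
  note D_closed = linear_mapD(1)[OF U.d_linear] and dA_closed = linear_mapD(1)[OF A.d_linear]
    and dB_closed = linear_mapD(1)[OF P.f.cod.d_linear]
  have iff: "mdiff_algebra_hom K lam (ue K A brA) (ue_mdiff K lam A brA dA) B dB \<phi> \<longleftrightarrow>
      algebra_hom K (ue K A brA) B \<phi>"
    if gen: "\<forall>a\<in>carrier A. \<phi> (ue_M K A brA a) = f a \<and> \<phi> (ue_H K A brA a) = g a" for \<phi>
  proof
    assume \<phi>: "algebra_hom K (ue K A brA) B \<phi>"
    note hom = algebra_homD[OF \<phi>]
    have "\<phi> (ue_mdiff K lam A brA dA x) = dB (\<phi> x)" if x: "x \<in> carrier (ue K A brA)" for x
    proof -
      \<comment> \<open>The weight 0 commutation applies to the shifted operators on both sides; as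
        \<phi> is linear, \<lambda>\<phi>(x) cancels.\<close>
      have "\<phi> (ue_mdiff K lam A brA dA x \<oplus>\<^bsub>ue K A brA\<^esub> lam \<odot>\<^bsub>ue K A brA\<^esub> x)
          = dB (\<phi> x) \<oplus>\<^bsub>B\<^esub> lam \<odot>\<^bsub>B\<^esub> \<phi> x"
        by (rule ue_hom_commutes_diff[OF A0 mdiff_algebra_shift[OF D(1)] mdiff_algebra_shift[OF B] \<phi> _ _ x])
          (use gen assms(3) in \<open>simp_all add: hom D(2,3) M_closed H_closed dA_closed
            P.f.comm_d P.g.comm_d\<close>)
      then show ?thesis
        using x assms(3) by (simp add: hom D_closed dB_closed)
    qed
    with \<phi> show "mdiff_algebra_hom K lam (ue K A brA) (ue_mdiff K lam A brA dA) B dB \<phi>"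
      using D(1) B by (intro mdiff_algebra_hom.intro mdiff_algebra_hom_axioms.intro)
  qed (rule mdiff_algebra_hom.hom)
  show "\<exists>!\<phi>. \<phi> \<in> extensional (carrier (ue K A brA)) \<and>
      mdiff_algebra_hom K lam (ue K A brA) (ue_mdiff K lam A brA dA) B dB \<phi> \<and>
      (\<forall>a\<in>carrier A. \<phi> (ue_M K A brA a) = f a \<and> \<phi> (ue_H K A brA a) = g a)"
  proof -
    have "\<phi> \<in> extensional (carrier (ue K A brA)) \<and>
        mdiff_algebra_hom K lam (ue K A brA) (ue_mdiff K lam A brA dA) B dB \<phi> \<and>
        (\<forall>a\<in>carrier A. \<phi> (ue_M K A brA a) = f a \<and> \<phi> (ue_H K A brA a) = g a) \<longleftrightarrow>
      \<phi> \<in> extensional (carrier (ue K A brA)) \<and> algebra_hom K (ue K A brA) B \<phi> \<and>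
        (\<forall>a\<in>carrier A. \<phi> (ue_M K A brA a) = f a \<and> \<phi> (ue_H K A brA a) = g a)" for \<phi>
      using iff by blast
    then show ?thesis
      by (simp only: ue_hom_ex1[OF A.assoc_algebra_axioms br_Pi[OF A0] P.f.cod.assoc_algebra_axioms fg])
  qed
qed

end
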